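(* Let $G$ be an lcsc group, $H$ a closed unimodular subgroup, $\Gamma$ a discrete lattice in $G$ acting ergodically on $X=G/H$, and suppose Assumptions 1–5 below hold. Then for $m_X$-almost every $x\in X$ and every $x_0\in X$, $\kappa_\Gamma(x,x_0)\le\frac{d-d'/2}{a'\theta}$.
   Context: Setting: $m_G$, $m_H$ Haar measures; $m_X$ the $G$-invariant measure on $X=G/H$ with $\int_G f\,dm_G=\int_X\int_H f(gh)\,dm_H(h)\,dm_X(gH)$; $Y=\Gamma\backslash G$ with $G$-invariant probability measure $\tilde m_Y$. $\mathrm{dist}$ is a metric on $X$, $\mathcal O_\epsilon(x_0)=\{x:\mathrm{dist}(x,x_0)<\epsilon\}$. $D:G\to\mathbb R_+$ is proper continuous, $|g|_D=e^{D(g)}$, $G_t=\{g:D(g)\le t\}$, $H_t=G_t\cap H$. For $x,x_0\in X$, $\kappa_\Gamma(x,x_0)$ is the infimum of $\zeta>0$ for which there exists $\epsilon_0>0$ such that for every $\epsilon\in(0,\epsilon_0)$ some $\gamma\in\Gamma$ satisfies $\mathrm{dist}(\gamma^{-1}x,x_0)\le\epsilon$ and $|\gamma|_D\le\epsilon^{-\zeta}$. Assumption 1: for all compact $\Omega\subset G$, $S\subset X$ there is $C_0$ with $\mathrm{dist}(gx,gx_0)\le C_0\,\mathrm{dist}(x,x_0)$ for $g\in\Omega$, $x,x_0\in S$. Assumption 2: for every compact $\Omega\subset G$ there is $b(\Omega)$ with $D(ugv)\le D(g)+b(\Omega)$ for $u,v\in\Omega$, $g\in G$. Assumption 3: there are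 $0<a'\le a<\infty$ such that for every $\eta>0$ there exist $C_2(\eta)\ge1$, $t_\eta$ with $C_2^{-1}e^{t(a'-\eta)}\le m_H(H_t)\le C_2e^{t(a+\eta)}$ for $t\ge t_\eta$; the same holds for every conjugate $gHg^{-1}$ (with $G_t\cap gHg^{-1}$), same $a,a'$, constants uniform for $g$ in compact sets. Assumption 4: there are $0<d'\le d<\infty$ such that for every $x_0$ and $\eta>0$ there exist $C_3(x_0,\eta)\ge1$, $\epsilon_0(x_0,\eta)$ with $C_3^{-1}\epsilon^{d+\eta}\le m_X(\mathcal O_\epsilon(x_0))\le C_3\epsilon^{d'-\eta}$ for $\epsilon\in(0,\epsilon_0)$, uniformly for $x_0$ in compact sets. Assumption 5: with $\pi_Y(\beta_t)f(y)=m_H(H_t)^{-1}\int_{H_t}f(yh)\,dm_H(h)$ on $L^2(Y,\tilde m_Y)$, there is $\theta>0$ such that for every $\eta>0$ there exist $C_4(\eta)$, $t_\eta$ with $\|\pi_Y(\beta_t)f-\int_Yf\,d\tilde m_Y\|_2\le C_4(\eta)m_H(H_t)^{-\theta+\eta}\|f\|_2$ for all $f$ and $t\ge t_\eta$; the same holds for every conjugate $gHg^{-1}$ with the same $\theta$ and constants uniform for $g$ in compact sets.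
   Formalization: "For almost every x and every x_0" is taken as: for every x_0, the bound holds for almost every x, with a null set that may depend on x_0; a single null set for all x_0 fails, e.g. for S-arithmetic lattices in SU(2) x SL_2(Q_p) with X = SU(2). *)

theory Defs
  imports "HOL-Probability.Probability_Measure" "HOL-Algebra.Left_Coset"
begin

section \<open>Locally compact second countable groups and their homogeneous spaces\<close>

locale lcsc_group = group G
  for G :: "('g::{second_countable_topology, t2_space}, 'm) monoid_scheme" (structure) +
  assumes carrier_UNIV: "carrier G = UNIV"
    and continuous_mult: "continuous_on UNIV (\<lambda>(x, y). x \<otimes> y)"
    and continuous_inv: "continuous_on UNIV (\<lambda>x. inv x)"
    and locally_compact: "locally_compact_space (euclidean :: 'g topology)"

text \<open>The finest topology on the range of \<open>p\<close> making \<open>p\<close> continuous.\<close>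

definition quotient_top :: "('g::topological_space \<Rightarrow> 'x) \<Rightarrow> 'x topology"
  where "quotient_top p = topology (\<lambda>U. U \<subseteq> range p \<and> open (p -` U))"

lemma openin_quotient_top: "openin (quotient_top p) U \<longleftrightarrow> U \<subseteq> range p \<and> open (p -` U)"
proof -
  have "istopology (\<lambda>U. U \<subseteq> range p \<and> open (p -` U))"
    unfolding istopology_def by (simp add: vimage_Union open_Int open_UN le_infI1 Sup_le_iff)
  then show ?thesis
    by (simp add: quotient_top_def)
qed

lemma topspace_quotient_top: "topspace (quotient_top p) = range p"
proof
  show "topspace (quotient_top p) \<subseteq> range p"
    using openin_topspace[of "quotient_top p"] unfolding openin_quotient_top by blast
  have "p -` range p = UNIV" by blast
  then have "openin (quotient_top p) (range p)"
    by (simp add: openin_quotient_top)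
  then show "range p \<subseteq> topspace (quotient_top p)"
    by (rule openin_subset)
qed

lemma quotient_map_quotient_top: "quotient_map euclidean (quotient_top p) p"
  unfolding quotient_map_def topspace_quotient_top openin_quotient_top
  by (simp add: vimage_def)

definition left_quotient ::
    "('g::topological_space, 'm) monoid_scheme \<Rightarrow> 'g set \<Rightarrow> 'g set topology"
  where "left_quotient G H = quotient_top (\<lambda>g. g <#\<^bsub>G\<^esub> H)"

definition right_quotient ::
    "('g::topological_space, 'm) monoid_scheme \<Rightarrow> 'g set \<Rightarrow> 'g set topology"
  where "right_quotient G \<Gamma> = quotient_top (\<lambda>g. \<Gamma> #>\<^bsub>G\<^esub> g)"

lemma (in lcsc_group) topspace_left_quotient: "topspace (left_quotient G H) = lcosets H"
  by (auto simp: left_quotient_def topspace_quotient_top LCOSETS_def carrier_UNIV)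

lemma (in lcsc_group) topspace_right_quotient: "topspace (right_quotient G \<Gamma>) = rcosets \<Gamma>"
  by (auto simp: right_quotient_def topspace_quotient_top RCOSETS_def carrier_UNIV)

definition borel_of :: "'x topology \<Rightarrow> 'x measure"
  where "borel_of T = sigma (topspace T) {U. openin T U}"


section \<open>Invariant measures\<close>

text \<open>A left Haar measure on a closed subgroup \<open>L\<close> of \<open>G\<close>, on the Borel sets of \<open>L\<close>.
  As \<open>L\<close> is second countable, finiteness on compact sets makes it a Radon measure.\<close>

definition haar_measure ::
    "('g::topological_space, 'm) monoid_scheme \<Rightarrow> 'g set \<Rightarrow> 'g measure \<Rightarrow> bool"
  where "haar_measure G L M \<longleftrightarrow>
    sets M = sets (restrict_space borel L) \<and>
    (\<forall>h\<in>L. \<forall>A\<in>sets M. emeasure M (h <#\<^bsub>G\<^esub> A) = emeasure M A) \<and>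
    (\<forall>K. compact K \<and> K \<subseteq> L \<longrightarrow> emeasure M K < \<infinity>) \<and>
    (\<forall>U. open U \<and> U \<inter> L \<noteq> {} \<longrightarrow> emeasure M (U \<inter> L) > 0)"

definition unimodular :: "('g::topological_space, 'm) monoid_scheme \<Rightarrow> 'g set \<Rightarrow> bool"
  where "unimodular G L \<longleftrightarrow>
    (\<forall>M. haar_measure G L M \<longrightarrow>
      (\<forall>h\<in>L. \<forall>A\<in>sets M. emeasure M (A #>\<^bsub>G\<^esub> h) = emeasure M A))"

text \<open>In the iterated integral \<open>SOME g. g \<in> x\<close> is a representative of the coset \<open>x\<close>; by left
  invariance of \<open>mH\<close> the inner integral does not depend on its choice.\<close>

definition quotient_measure ::
    "('g::topological_space, 'm) monoid_scheme \<Rightarrow> 'g set \<Rightarrow> 'g measure \<Rightarrow> 'g measure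
      \<Rightarrow> 'g set measure \<Rightarrow> bool"
  where "quotient_measure G H mG mH mX \<longleftrightarrow>
    sets mX = sets (borel_of (left_quotient G H)) \<and>
    (\<forall>g. \<forall>A\<in>sets mX. emeasure mX ((\<lambda>x. g <#\<^bsub>G\<^esub> x) ` A) = emeasure mX A) \<and>
    (\<forall>f\<in>borel_measurable borel.
      (\<integral>\<^sup>+g. f g \<partial>mG) = (\<integral>\<^sup>+x. (\<integral>\<^sup>+h. f ((SOME g. g \<in> x) \<otimes>\<^bsub>G\<^esub> h) \<partial>mH) \<partial>mX))"

definition invariant_prob ::
    "('g::topological_space, 'm) monoid_scheme \<Rightarrow> 'g set \<Rightarrow> 'g set measure \<Rightarrow> bool"
  where "invariant_prob G \<Gamma> mY \<longleftrightarrow>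
    prob_space mY \<and>
    sets mY = sets (borel_of (right_quotient G \<Gamma>)) \<and>
    (\<forall>g. \<forall>A\<in>sets mY. emeasure mY ((\<lambda>y. y #>\<^bsub>G\<^esub> g) ` A) = emeasure mY A)"

definition discrete_lattice :: "('g::topological_space, 'm) monoid_scheme \<Rightarrow> 'g set \<Rightarrow> bool"
  where "discrete_lattice G \<Gamma> \<longleftrightarrow>
    subgroup \<Gamma> G \<and> discrete \<Gamma> \<and> (\<exists>mY. invariant_prob G \<Gamma> mY)"

definition ergodic_action ::
    "('g, 'm) monoid_scheme \<Rightarrow> 'g set \<Rightarrow> 'g set measure \<Rightarrow> bool"
  where "ergodic_action G \<Gamma> mX \<longleftrightarrow>
    (\<forall>A\<in>sets mX. (\<forall>\<gamma>\<in>\<Gamma>. (\<lambda>x. \<gamma> <#\<^bsub>G\<^esub> x) ` A = A) \<longrightarrow>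
      emeasure mX A = 0 \<or> emeasure mX (space mX - A) = 0)"


section \<open>The size function and the approximation exponent\<close>

definition proper_size :: "('g::topological_space \<Rightarrow> real) \<Rightarrow> bool"
  where "proper_size D \<longleftrightarrow>
    (\<forall>g. 0 \<le> D g) \<and> continuous_on UNIV D \<and> (\<forall>K. compact K \<longrightarrow> compact (D -` K))"

definition sublevel :: "('g \<Rightarrow> real) \<Rightarrow> real \<Rightarrow> 'g set"
  where "sublevel D t = {g. D g \<le> t}"

text \<open>The value is \<open>\<infinity>\<close> if no exponent \<open>\<zeta>\<close> is admissible.\<close>

definition approx_exponent ::
    "('g, 'm) monoid_scheme \<Rightarrow> 'g set \<Rightarrow> ('g set \<Rightarrow> 'g set \<Rightarrow> real) \<Rightarrow> ('g \<Rightarrow> real)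
      \<Rightarrow> 'g set \<Rightarrow> 'g set \<Rightarrow> ereal"
  where "approx_exponent G \<Gamma> dst D x x0 =
    Inf {ereal \<zeta> | \<zeta>. \<zeta> > 0 \<and>
      (\<exists>\<epsilon>0>0. \<forall>\<epsilon>. 0 < \<epsilon> \<and> \<epsilon> < \<epsilon>0 \<longrightarrow>
        (\<exists>\<gamma>\<in>\<Gamma>. dst (inv\<^bsub>G\<^esub> \<gamma> <#\<^bsub>G\<^esub> x) x0 \<le> \<epsilon> \<and> exp (D \<gamma>) \<le> \<epsilon> powr (- \<zeta>)))}"


section \<open>Assumptions on the metric, the size function and the averages\<close>

definition lipschitz_action ::
    "('g::topological_space, 'm) monoid_scheme \<Rightarrow> 'g set \<Rightarrow> ('g set \<Rightarrow> 'g set \<Rightarrow> real) \<Rightarrow> bool"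
  where "lipschitz_action G H dst \<longleftrightarrow>
    (\<forall>\<Omega> S. compact \<Omega> \<and> compactin (left_quotient G H) S \<longrightarrow>
      (\<exists>C0. \<forall>g\<in>\<Omega>. \<forall>x\<in>S. \<forall>x0\<in>S. dst (g <#\<^bsub>G\<^esub> x) (g <#\<^bsub>G\<^esub> x0) \<le> C0 * dst x x0))"

definition coarsely_stable ::
    "('g::topological_space, 'm) monoid_scheme \<Rightarrow> ('g \<Rightarrow> real) \<Rightarrow> bool"
  where "coarsely_stable G D \<longleftrightarrow>
    (\<forall>\<Omega>. compact \<Omega> \<longrightarrow>
      (\<exists>b. \<forall>u\<in>\<Omega>. \<forall>v\<in>\<Omega>. \<forall>g. D (u \<otimes>\<^bsub>G\<^esub> g \<otimes>\<^bsub>G\<^esub> v) \<le> D g + b))"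

definition conj_subgroup :: "('g, 'm) monoid_scheme \<Rightarrow> 'g \<Rightarrow> 'g set \<Rightarrow> 'g set"
  where "conj_subgroup G g H = (\<lambda>h. g \<otimes>\<^bsub>G\<^esub> h \<otimes>\<^bsub>G\<^esub> inv\<^bsub>G\<^esub> g) ` H"

text \<open>Bounds uniform in \<open>g\<close> presuppose compatible normalizations of the Haar measures on the
  conjugates \<open>gHg\<^sup>-\<^sup>1\<close>: they are the images of the one on \<open>H\<close>. The group \<open>H\<close> itself is the
  case \<open>g = \<one>\<close>.\<close>

definition conj_measure ::
    "('g::topological_space, 'm) monoid_scheme \<Rightarrow> 'g \<Rightarrow> 'g set \<Rightarrow> 'g measure \<Rightarrow> 'g measure"
  where "conj_measure G g H mH =
    distr mH (restrict_space borel (conj_subgroup G g H)) (\<lambda>h. g \<otimes>\<^bsub>G\<^esub> h \<otimes>\<^bsub>G\<^esub> inv\<^bsub>G\<^esub> g)"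

definition ball_volume ::
    "('g::topological_space, 'm) monoid_scheme \<Rightarrow> 'g set \<Rightarrow> 'g measure \<Rightarrow> ('g \<Rightarrow> real)
      \<Rightarrow> 'g \<Rightarrow> real \<Rightarrow> real"
  where "ball_volume G H mH D g t =
    measure (conj_measure G g H mH) (sublevel D t \<inter> conj_subgroup G g H)"

definition volume_growth ::
    "('g::topological_space, 'm) monoid_scheme \<Rightarrow> 'g set \<Rightarrow> 'g measure \<Rightarrow> ('g \<Rightarrow> real)
      \<Rightarrow> real \<Rightarrow> real \<Rightarrow> bool"
  where "volume_growth G H mH D a' a \<longleftrightarrow>
    0 < a' \<and> a' \<le> a \<and>
    (\<forall>\<Omega>. compact \<Omega> \<longrightarrow> (\<forall>\<eta>>0. \<exists>C2\<ge>1. \<exists>t\<^sub>\<eta>. \<forall>g\<in>\<Omega>. \<forall>t\<ge>t\<^sub>\<eta>.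
      inverse C2 * exp (t * (a' - \<eta>)) \<le> ball_volume G H mH D g t \<and>
      ball_volume G H mH D g t \<le> C2 * exp (t * (a + \<eta>))))"

definition local_dimension ::
    "('g::topological_space, 'm) monoid_scheme \<Rightarrow> 'g set \<Rightarrow> 'g set measure
      \<Rightarrow> ('g set \<Rightarrow> 'g set \<Rightarrow> real) \<Rightarrow> real \<Rightarrow> real \<Rightarrow> bool"
  where "local_dimension G H mX dst d' d \<longleftrightarrow>
    0 < d' \<and> d' \<le> d \<and>
    (\<forall>S. compactin (left_quotient G H) S \<longrightarrow> (\<forall>\<eta>>0. \<exists>C3\<ge>1. \<exists>\<epsilon>0>0.
      \<forall>x0\<in>S. \<forall>\<epsilon>. 0 < \<epsilon> \<and> \<epsilon> < \<epsilon>0 \<longrightarrow>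
        ennreal (inverse C3 * \<epsilon> powr (d + \<eta>))
          \<le> emeasure mX (Metric_space.mball (lcosets\<^bsub>G\<^esub> H) dst x0 \<epsilon>) \<and>
        emeasure mX (Metric_space.mball (lcosets\<^bsub>G\<^esub> H) dst x0 \<epsilon>)
          \<le> ennreal (C3 * \<epsilon> powr (d' - \<eta>))))"

definition L2 :: "'y measure \<Rightarrow> ('y \<Rightarrow> complex) set"
  where "L2 M = {f \<in> borel_measurable M. integrable M (\<lambda>y. (cmod (f y))\<^sup>2)}"

definition L2_norm :: "'y measure \<Rightarrow> ('y \<Rightarrow> complex) \<Rightarrow> real"
  where "L2_norm M f = sqrt (\<integral>y. (cmod (f y))\<^sup>2 \<partial>M)"

definition ball_average ::
    "('g::topological_space, 'm) monoid_scheme \<Rightarrow> 'g set \<Rightarrow> 'g measure \<Rightarrow> ('g \<Rightarrow> real)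
      \<Rightarrow> 'g \<Rightarrow> real \<Rightarrow> ('g set \<Rightarrow> complex) \<Rightarrow> 'g set \<Rightarrow> complex"
  where "ball_average G H mH D g t f y =
    inverse (ball_volume G H mH D g t) *\<^sub>R
      (LINT h : sublevel D t \<inter> conj_subgroup G g H | conj_measure G g H mH. f (y #>\<^bsub>G\<^esub> h))"

definition mean_ergodic_rate ::
    "('g::topological_space, 'm) monoid_scheme \<Rightarrow> 'g set \<Rightarrow> 'g measure \<Rightarrow> ('g \<Rightarrow> real)
      \<Rightarrow> 'g set measure \<Rightarrow> real \<Rightarrow> bool"
  where "mean_ergodic_rate G H mH D mY \<theta> \<longleftrightarrow>
    0 < \<theta> \<and>
    (\<forall>\<Omega>. compact \<Omega> \<longrightarrow> (\<forall>\<eta>>0. \<exists>C4 t\<^sub>\<eta>. \<forall>g\<in>\<Omega>. \<forall>t\<ge>t\<^sub>\<eta>. \<forall>f\<in>L2 mY.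
      L2_norm mY (\<lambda>y. ball_average G H mH D g t f y - (\<integral>z. f z \<partial>mY))
        \<le> C4 * ball_volume G H mH D g t powr (- \<theta> + \<eta>) * L2_norm mY f))"

end

theory Submission
  imports Defs
begin

text \<open>Fix \<open>x0 = g0 H\<close>. A small ball \<open>B\<close> around \<open>x0\<close> lifts to an open set \<open>E\<close>, inside a fixed
  compact subset of \<open>G\<close>, whose image \<open>\<Gamma>E\<close> in \<open>\<Gamma>\G\<close> has measure at least a constant times
  \<open>mX B\<close>. If \<open>\<Gamma>gh = \<Gamma>e\<close> with \<open>h \<in> H\<^sub>t\<close> and \<open>e \<in> E\<close>, then \<open>\<gamma> = g h e\<^sup>-\<^sup>1 \<in> \<Gamma>\<close> satisfies
  \<open>\<gamma>\<^sup>-\<^sup>1gH = eH \<in> B\<close> and \<open>D \<gamma> \<le> t + O(1)\<close>. The average over \<open>H\<^sub>t\<close> of the indicator of \<open>\<Gamma>E\<close>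
  vanishes at the points \<open>y\<close> for which \<open>y H\<^sub>t\<close> misses \<open>\<Gamma>E\<close>, so the mean ergodic estimate and
  Chebyshev's inequality bound the measure of these points by a multiple of
  \<open>mH(H\<^sub>t)\<^bsup>-2\<theta>+2\<eta>\<^esup> / mY(\<Gamma>E)\<close>. For radius \<open>2\<^bsup>-n\<^esup>\<close> and \<open>t = \<zeta> n ln 2\<close> these bounds are summable as soon
  as \<open>2\<zeta>a'\<theta> > d\<close>, which \<open>\<zeta> > (d - d'/2) / (a'\<theta>)\<close> implies because \<open>d' \<le> d\<close>; the
  Borel-Cantelli lemma then gives the claim for almost every \<open>\<Gamma>g\<close>, hence for almost every \<open>gH\<close>.\<close>

section \<open>Cosets and quotient topologies\<close>

lemma space_borel_of: "space (borel_of T) = topspace T"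
  by (simp add: borel_of_def space_measure_of_conv)

lemma sets_borel_of: "sets (borel_of T) = sigma_sets (topspace T) {U. openin T U}"
  unfolding borel_of_def by (rule sets_measure_of) (auto dest: openin_subset)

lemma openin_sets_borel_of: "openin T U \<Longrightarrow> U \<in> sets (borel_of T)"
  by (auto simp: sets_borel_of)

lemma two_powr_minus_tendsto_0: "(\<lambda>n. 2 powr (- real n)) \<longlonglongrightarrow> 0"
proof -
  have "2 powr (- real n) = (1 / 2) ^ n" for n
    by (simp add: powr_minus powr_realpow power_one_over inverse_eq_divide)
  then show ?thesis
    by (simp add: LIMSEQ_power_zero)
qed

context lcsc_group
begin

lemma in_carrier [simp]: "x \<in> carrier G"
  by (simp add: carrier_UNIV)

lemma mult_cancel_inv [simp]:
  "inv x \<otimes> (x \<otimes> y) = y" "x \<otimes> (inv x \<otimes> y) = y"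
  "y \<otimes> x \<otimes> inv x = y" "y \<otimes> inv x \<otimes> x = y"
  by (simp_all add: m_assoc[symmetric]) (simp_all add: m_assoc)

lemma mem_l_coset: "x \<in> g <# A \<longleftrightarrow> inv g \<otimes> x \<in> A"
proof
  show "x \<in> g <# A" if "inv g \<otimes> x \<in> A"
    using that unfolding l_coset_def by (auto intro!: bexI[of _ "inv g \<otimes> x"])
qed (auto simp: l_coset_def)

lemma mem_r_coset: "x \<in> A #> g \<longleftrightarrow> x \<otimes> inv g \<in> A"
proof
  show "x \<in> A #> g" if "x \<otimes> inv g \<in> A"
    using that unfolding r_coset_def by (auto intro!: bexI[of _ "x \<otimes> inv g"])
qed (auto simp: r_coset_def)

lemma rcoset_eq_iff:
  assumes "subgroup L G"
  shows "L #> x = L #> y \<longleftrightarrow> x \<otimes> inv y \<in> L"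
proof
  assume "L #> x = L #> y"
  moreover have "x \<in> L #> x"
    using assms by (simp add: mem_r_coset subgroup.one_closed)
  ultimately show "x \<otimes> inv y \<in> L"
    by (simp add: mem_r_coset)
next
  assume *: "x \<otimes> inv y \<in> L"
  have "z \<otimes> inv x \<in> L \<longleftrightarrow> z \<otimes> inv y \<in> L" for z
  proof
    assume "z \<otimes> inv x \<in> L"
    then have "(z \<otimes> inv x) \<otimes> (x \<otimes> inv y) \<in> L"
      using * assms by (simp add: subgroup.m_closed)
    then show "z \<otimes> inv y \<in> L"
      by (simp add: m_assoc)
  next
    assume "z \<otimes> inv y \<in> L"
    then have "(z \<otimes> inv y) \<otimes> inv (x \<otimes> inv y) \<in> L"
      using * assms by (simp add: subgroup.m_closed subgroup.m_inv_closed)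
    then show "z \<otimes> inv x \<in> L"
      by (simp add: m_assoc inv_mult_group)
  qed
  then show "L #> x = L #> y"
    by (auto simp: mem_r_coset)
qed

lemma lcoset_eq_iff:
  assumes "subgroup L G"
  shows "x <# L = y <# L \<longleftrightarrow> inv x \<otimes> y \<in> L"
proof
  assume "x <# L = y <# L"
  moreover have "y \<in> y <# L"
    using assms by (simp add: mem_l_coset subgroup.one_closed)
  ultimately show "inv x \<otimes> y \<in> L"
    by (metis mem_l_coset)
next
  assume *: "inv x \<otimes> y \<in> L"
  have "inv x \<otimes> z \<in> L \<longleftrightarrow> inv y \<otimes> z \<in> L" for z
  proof
    assume "inv x \<otimes> z \<in> L"
    then have "inv (inv x \<otimes> y) \<otimes> (inv x \<otimes> z) \<in> L"
      using * assms by (simp add: subgroup.m_closed subgroup.m_inv_closed)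
    then show "inv y \<otimes> z \<in> L"
      by (simp add: m_assoc inv_mult_group)
  next
    assume "inv y \<otimes> z \<in> L"
    then have "(inv x \<otimes> y) \<otimes> (inv y \<otimes> z) \<in> L"
      using * assms by (simp add: subgroup.m_closed)
    then show "inv x \<otimes> z \<in> L"
      by (simp add: m_assoc)
  qed
  then show "x <# L = y <# L"
    by (auto simp: mem_l_coset)
qed

section \<open>Translations and the topology of the multiplication map\<close>

lemma continuous_on_l_mult: "continuous_on S (\<lambda>x. g \<otimes> x)"
proof -
  have "continuous_on S (\<lambda>x. (g, x))"
    by (intro continuous_on_Pair continuous_on_const continuous_on_id)
  from continuous_on_compose2[OF continuous_mult this] show ?thesis by simp
qed

lemma continuous_on_r_mult: "continuous_on S (\<lambda>x. x \<otimes> g)"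
proof -
  have "continuous_on S (\<lambda>x. (x, g))"
    by (intro continuous_on_Pair continuous_on_const continuous_on_id)
  from continuous_on_compose2[OF continuous_mult this] show ?thesis by simp
qed

lemma open_l_coset: "open U \<Longrightarrow> open (g <# U)"
  using open_vimage[OF _ continuous_on_l_mult, of U "inv g"]
  by (simp add: vimage_def mem_l_coset[symmetric])

lemma open_r_coset: "open U \<Longrightarrow> open (U #> g)"
  using open_vimage[OF _ continuous_on_r_mult, of U "inv g"]
  by (simp add: vimage_def mem_r_coset[symmetric])

lemma compact_l_coset: "compact K \<Longrightarrow> compact (g <# K)"
  using compact_continuous_image[OF continuous_on_l_mult, of K g]
  by (simp add: l_coset_def UNION_singleton_eq_range)

lemma borel_l_coset: 
  assumes "A \<in> sets borel" shows "g <# A \<in> sets borel"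
proof -
  have "(\<lambda>x. inv g \<otimes> x) \<in> borel_measurable borel"
    by (intro borel_measurable_continuous_onI continuous_on_l_mult)
  from measurable_sets[OF this assms] show ?thesis
    by (simp add: vimage_def mem_l_coset[symmetric])
qed

text \<open>Multiplication is continuous and the product topology has a countable basis of open
  rectangles. Countability later turns openness into membership in product \<sigma>-algebras and
  fibres into countable unions.\<close>

lemma open_mult_countable_rectangles:
  assumes "open U"
  obtains A B :: "nat \<Rightarrow> 'g set"
  where "\<And>n. open (A n)" "\<And>n. open (B n)"
    "\<And>x y. x \<otimes> y \<in> U \<longleftrightarrow> (\<exists>n. x \<in> A n \<and> y \<in> B n)"
proof -
  obtain \<B> :: "'g set set" where \<B>: "countable \<B>" "topological_basis \<B>"
    using ex_countable_basis by blast
  let ?W = "(\<lambda>(x, y). x \<otimes> y) -` U"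
  have W: "open ?W"
    using open_vimage[OF assms continuous_mult] .
  \<comment> \<open>The empty rectangle keeps \<open>R\<close> nonempty, so that
    \<open>from_nat_into R\<close> enumerates exactly \<open>R\<close>.\<close>
  define R where "R = insert ({}, {}) {(a, b) \<in> \<B> \<times> \<B>. a \<times> b \<subseteq> ?W}"
  have cR: "countable R"
    unfolding R_def using \<B>(1) by (intro countable_insert) (auto intro: countable_subset[of _ "\<B> \<times> \<B>"])
  have range: "range (from_nat_into R) = R"
    using cR by (intro range_from_nat_into) (auto simp: R_def)
  show thesis
  proof
    fix n
    have "from_nat_into R n \<in> R"
      using range by blast
    then show "open (fst (from_nat_into R n))" "open (snd (from_nat_into R n))"
      using topological_basis_open[OF \<B>(2)] by (auto simp: R_def)
  next
    fix x y
    have "x \<otimes> y \<in> U \<longleftrightarrow> (\<exists>r\<in>R. x \<in> fst r \<and> y \<in> snd r)"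
    proof
      assume "x \<otimes> y \<in> U"
      then have xy: "(x, y) \<in> ?W" by simp
      obtain c where c: "c \<in> (\<lambda>(a, b). a \<times> b) ` (\<B> \<times> \<B>)" "(x, y) \<in> c" "c \<subseteq> ?W"
        by (rule topological_basisE[OF topological_basis_prod[OF \<B>(2) \<B>(2)] W xy])
      then obtain a b where "a \<in> \<B>" "b \<in> \<B>" "c = a \<times> b" by blast
      then show "\<exists>r\<in>R. x \<in> fst r \<and> y \<in> snd r"
        using c by (intro bexI[of _ "(a, b)"]) (auto simp: R_def)
    qed (auto simp: R_def)
    also have "\<dots> \<longleftrightarrow> (\<exists>r\<in>range (from_nat_into R). x \<in> fst r \<and> y \<in> snd r)"
      by (simp only: range)
    also have "\<dots> \<longleftrightarrow> (\<exists>n. x \<in> fst (from_nat_into R n) \<and> y \<in> snd (from_nat_into R n))"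
      by blast
    finally show "x \<otimes> y \<in> U \<longleftrightarrow> (\<exists>n. x \<in> fst (from_nat_into R n) \<and> y \<in> snd (from_nat_into R n))" .
  qed
qed

section \<open>Open projections and measurability of the right action\<close>

lemma rcoset_in_right_quotient [simp]: "L #> g \<in> topspace (right_quotient G L)"
  by (simp add: right_quotient_def topspace_quotient_top)

lemma right_quotient_cases:
  assumes "y \<in> topspace (right_quotient G L)"
  obtains g where "y = L #> g"
  using assms by (auto simp: right_quotient_def topspace_quotient_top)

text \<open>The saturation of \<open>U\<close> is the union of the translates \<open>l <# U\<close>
  over \<open>l\<close> in \<open>L\<close>, which is open.\<close>

lemma openin_right_quotient_image:
  assumes L: "subgroup L G" and U: "open U"
  shows "openin (right_quotient G L) ((\<lambda>g. L #> g) ` U)"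
proof -
  have "(\<lambda>g. L #> g) -` ((\<lambda>g. L #> g) ` U) = (\<Union>l\<in>L. l <# U)" (is "?A = ?B")
  proof (intro equalityI subsetI)
    fix x assume "x \<in> ?A"
    then obtain u where "u \<in> U" "L #> x = L #> u" by auto
    then show "x \<in> ?B"
      using L by (auto simp: rcoset_eq_iff mem_l_coset inv_mult_group m_assoc intro!: bexI[of _ "x \<otimes> inv u"])
  next
    fix x assume "x \<in> ?B"
    then obtain l where l: "l \<in> L" "inv l \<otimes> x \<in> U" by (auto simp: mem_l_coset)
    then have "L #> x = L #> (inv l \<otimes> x)"
      using L by (simp add: rcoset_eq_iff inv_mult_group m_assoc[symmetric])
    then show "x \<in> ?A" using l by auto
  qed
  then show ?thesis
    using U by (auto simp: right_quotient_def openin_quotient_top intro: open_l_coset)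
qed

lemma openin_left_quotient_image:
  assumes L: "subgroup L G" and U: "open U"
  shows "openin (left_quotient G L) ((\<lambda>g. g <# L) ` U)"
proof -
  have "(\<lambda>g. g <# L) -` ((\<lambda>g. g <# L) ` U) = (\<Union>l\<in>L. U #> l)" (is "?A = ?B")
  proof (intro equalityI subsetI)
    fix x assume "x \<in> ?A"
    then obtain u where "u \<in> U" "u <# L = x <# L" by auto
    then show "x \<in> ?B"
      using L by (auto simp: lcoset_eq_iff mem_r_coset inv_mult_group m_assoc[symmetric] intro!: bexI[of _ "inv u \<otimes> x"])
  next
    fix x assume "x \<in> ?B"
    then obtain l where l: "l \<in> L" "x \<otimes> inv l \<in> U" by (auto simp: mem_r_coset)
    then have "(x \<otimes> inv l) <# L = x <# L"
      using L by (simp add: lcoset_eq_iff inv_mult_group m_assoc)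
    then show "x \<in> ?A" using l by (metis image_eqI vimageI)
  qed
  then show ?thesis
    using U by (auto simp: left_quotient_def openin_quotient_top intro: open_r_coset)
qed

lemma measurable_right_quotient:
  assumes "sets M = sets (borel_of (right_quotient G L))"
  shows "(\<lambda>g. L #> g) \<in> measurable borel M"
proof (rule measurable_sigma_sets)
  show "sets M = sigma_sets (topspace (right_quotient G L)) {U. openin (right_quotient G L) U}"
    using assms by (simp add: sets_borel_of)
next
  fix V assume "V \<in> {U. openin (right_quotient G L) U}"
  then show "(\<lambda>g. L #> g) -` V \<inter> space borel \<in> sets borel"
    by (simp add: right_quotient_def openin_quotient_top)
qed (auto dest: openin_subset)

text \<open>Pulled back to pairs of group elements, the preimage of an open set is a countable union
  of open rectangles. Membership depends only on the coset of the first entry, and projections of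
  open sets are open, so the preimage in the quotient is a countable union of measurable
  rectangles.\<close>

lemma measurable_right_action:
  assumes L: "subgroup L G" and M: "sets M = sets (borel_of (right_quotient G L))"
  shows "(\<lambda>(y, x). y #> x) \<in> measurable (M \<Otimes>\<^sub>M borel) M"
proof (rule measurable_sigma_sets)
  have space: "space M = topspace (right_quotient G L)"
    using sets_eq_imp_space_eq[OF M] by (simp add: space_borel_of)
  show "sets M = sigma_sets (topspace (right_quotient G L)) {U. openin (right_quotient G L) U}"
    using M by (simp add: sets_borel_of)
  show "{U. openin (right_quotient G L) U} \<subseteq> Pow (topspace (right_quotient G L))"
    by (auto dest: openin_subset)
  show "(\<lambda>(y, x). y #> x) \<in> space (M \<Otimes>\<^sub>M borel) \<rightarrow> topspace (right_quotient G L)"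
    by (auto simp: space_pair_measure space coset_mult_assoc carrier_UNIV elim!: right_quotient_cases)
  fix V assume "V \<in> {U. openin (right_quotient G L) U}"
  then have "open ((\<lambda>g. L #> g) -` V)"
    by (simp add: right_quotient_def openin_quotient_top)
  then obtain A B where AB: "\<And>n. open (A n)" "\<And>n. open (B n)"
    "\<And>x y. x \<otimes> y \<in> (\<lambda>g. L #> g) -` V \<longleftrightarrow> (\<exists>n::nat. x \<in> A n \<and> y \<in> B n)"
    by (rule open_mult_countable_rectangles) blast
  have "(\<lambda>(y, x). y #> x) -` V \<inter> space (M \<Otimes>\<^sub>M borel) = (\<Union>n. ((\<lambda>g. L #> g) ` A n) \<times> B n)"
    (is "?A = ?B")
  proof (intro equalityI subsetI)
    fix z assume z: "z \<in> ?A"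
    then obtain g x where gx: "z = (L #> g, x)"
      by (auto simp: space_pair_measure space elim!: right_quotient_cases)
    then have "g \<otimes> x \<in> (\<lambda>g. L #> g) -` V"
      using z by (simp add: coset_mult_assoc carrier_UNIV)
    then show "z \<in> ?B"
      using AB(3) gx by auto
  next
    fix z assume "z \<in> ?B"
    then obtain n g x where *: "z = (L #> g, x)" "g \<in> A n" "x \<in> B n"
      by auto
    then have "g \<otimes> x \<in> (\<lambda>g. L #> g) -` V"
      using AB(3) by blast
    then show "z \<in> ?A"
      using * by (simp add: coset_mult_assoc carrier_UNIV space_pair_measure space)
  qed
  also have "\<dots> \<in> sets (M \<Otimes>\<^sub>M borel)"
    using AB(1,2) openin_right_quotient_image[OF L] M
    by (intro sets.countable_UN' pair_measureI) (auto intro!: openin_sets_borel_of)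
  finally show "(\<lambda>(y, x). y #> x) -` V \<inter> space (M \<Otimes>\<^sub>M borel) \<in> sets (M \<Otimes>\<^sub>M borel)" .
qed


section \<open>Comparison of the measures on the group and on the right quotient\<close>

lemma compact_neighbourhood:
  fixes x :: 'g
  obtains U K where "open U" "compact K" "x \<in> U" "U \<subseteq> K"
proof -
  have "\<exists>U K. open U \<and> compact K \<and> x \<in> U \<and> U \<subseteq> K"
    using locally_compact unfolding locally_compact_space_def open_openin[symmetric] compactin_euclidean_iff
    by auto
  then show thesis
    using that by blast
qed

text \<open>Lindelof applied to the precompact open sets. The cover gives \<sigma>-finiteness of
  Haar measures and localizes null sets to pieces with finite fibre volumes.\<close>

lemma countable_precompact_cover:
  obtains \<U> :: "'g set set"
  where "countable \<U>" "\<And>U. U \<in> \<U> \<Longrightarrow> open U \<and> (\<exists>K. compact K \<and> U \<subseteq> K)" "\<Union>\<U> = UNIV"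
proof -
  define \<V> where "\<V> = {U::'g set. open U \<and> (\<exists>K. compact K \<and> U \<subseteq> K)}"
  have "open U" if "U \<in> \<V>" for U
    using that by (simp add: \<V>_def)
  then obtain \<U> where \<U>: "\<U> \<subseteq> \<V>" "countable \<U>" "\<Union>\<U> = \<Union>\<V>"
    by (rule Lindelof)
  have "x \<in> \<Union>\<V>" for x
  proof -
    obtain U K where "open U" "compact K" "x \<in> U" "U \<subseteq> K"
      by (rule compact_neighbourhood)
    then show ?thesis
      unfolding \<V>_def by blast
  qed
  then have "\<Union>\<U> = UNIV"
    using \<U>(3) by blast
  with \<U> show thesis
    by (intro that[of \<U>]) (auto simp: \<V>_def)
qed

lemma space_haar_measure: "haar_measure G L M \<Longrightarrow> space M = L"
  unfolding haar_measure_def by (metis sets_eq_imp_space_eq space_restrict_space space_borel Int_UNIV_right)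

lemma haar_measure_sets_iff:
  "haar_measure G L M \<Longrightarrow> L \<in> sets borel \<Longrightarrow> A \<in> sets M \<longleftrightarrow> A \<subseteq> L \<and> A \<in> sets borel"
  unfolding haar_measure_def by (simp add: sets_restrict_space_iff)

lemma emeasure_haar_l_coset:
  assumes "haar_measure G L M" "h \<in> L" "A \<in> sets M"
  shows "emeasure M (h <# A) = emeasure M A"
  using assms by (simp add: haar_measure_def)

lemma emeasure_haar_compact:
  assumes "closed L" "haar_measure G L M" "compact K"
  shows "emeasure M (L \<inter> K) < \<infinity>"
  using assms closed_Int_compact[of L K] unfolding haar_measure_def by simp

lemma sigma_finite_haar_measure:
  assumes "closed L" "haar_measure G L M"
  shows "sigma_finite_measure M"
proof -
  obtain \<U> :: "'g set set" where \<U>: "countable \<U>"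
    "\<And>U. U \<in> \<U> \<Longrightarrow> open U \<and> (\<exists>K. compact K \<and> U \<subseteq> K)" "\<Union>\<U> = UNIV"
    by (rule countable_precompact_cover) blast
  show ?thesis
  proof
    show "\<exists>A. countable A \<and> A \<subseteq> sets M \<and> \<Union>A = space M \<and> (\<forall>a\<in>A. emeasure M a \<noteq> \<infinity>)"
    proof (intro exI[of _ "(\<lambda>U. L \<inter> U) ` \<U>"] conjI ballI)
      show "(\<lambda>U. L \<inter> U) ` \<U> \<subseteq> sets M"
        using assms \<U>(2) by (auto simp: haar_measure_sets_iff borel_closed borel_open)
      show "\<Union>((\<lambda>U. L \<inter> U) ` \<U>) = space M"
        using \<U>(3) by (auto simp: space_haar_measure[OF assms(2)])
      fix a assume "a \<in> (\<lambda>U. L \<inter> U) ` \<U>"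
      then obtain U where U: "U \<in> \<U>" "a = L \<inter> U"
        by blast
      moreover obtain K where "compact K" "U \<subseteq> K"
        using \<U>(2)[OF U(1)] by blast
      moreover from this have "L \<inter> K \<in> sets M"
        using assms sets.Int[OF borel_closed[OF assms(1)] borel_compact[OF \<open>compact K\<close>]]
        by (simp add: haar_measure_sets_iff borel_closed)
      ultimately have "emeasure M a \<le> emeasure M (L \<inter> K)"
        by (intro emeasure_mono) auto
      also have "\<dots> < \<infinity>"
        using emeasure_haar_compact[OF assms] \<open>compact K\<close> .
      finally show "emeasure M a \<noteq> \<infinity>" by simp
    qed (use \<U>(1) in simp)
  qed
qed

lemma emeasure_haar_UNIV:
  assumes "haar_measure G UNIV M" "A \<in> sets borel"
  shows "emeasure M (g <# A) = emeasure M A"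
  using assms haar_measure_sets_iff[OF assms(1)] unfolding haar_measure_def by auto

section \<open>The invariant probability measure on the right quotient\<close>

context
  fixes \<Gamma> :: "'g set" and mY :: "'g set measure"
  assumes \<Gamma>: "subgroup \<Gamma> G" and mY: "invariant_prob G \<Gamma> mY"
begin

lemma sets_mY: "sets mY = sets (borel_of (right_quotient G \<Gamma>))"
  using mY by (simp add: invariant_prob_def)

lemma space_mY: "space mY = topspace (right_quotient G \<Gamma>)"
  using sets_eq_imp_space_eq[OF sets_mY] by (simp add: space_borel_of)

lemma prob_space_mY: "prob_space mY"
  using mY by (simp add: invariant_prob_def)

lemma rcoset_in_mY: "\<Gamma> #> g \<in> space mY"
  by (simp add: space_mY)

lemma mY_cases:
  assumes "y \<in> space mY"
  obtains g where "y = \<Gamma> #> g"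
  using assms unfolding space_mY by (rule right_quotient_cases)

lemma rcoset_image_in_sets: "open U \<Longrightarrow> (\<lambda>g. \<Gamma> #> g) ` U \<in> sets mY"
  unfolding sets_mY by (intro openin_sets_borel_of openin_right_quotient_image \<Gamma>)

text \<open>Invariance is given for images; the preimage under translation by \<open>x\<close> is
  the image under translation by \<open>inv x\<close>.\<close>

lemma emeasure_mY_translate:
  assumes "A \<in> sets mY"
  shows "emeasure mY {y \<in> space mY. y #> x \<in> A} = emeasure mY A"
proof -
  have "{y \<in> space mY. y #> x \<in> A} = (\<lambda>y. y #> inv x) ` A"
  proof (intro equalityI subsetI)
    fix y assume "y \<in> {y \<in> space mY. y #> x \<in> A}"
    then have "y #> x \<in> A" "y = (y #> x) #> inv x"
      by (auto elim!: mY_cases simp: coset_mult_assoc carrier_UNIV m_assoc)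
    then show "y \<in> (\<lambda>y. y #> inv x) ` A" by blast
  next
    fix y assume "y \<in> (\<lambda>y. y #> inv x) ` A"
    then obtain z where z: "z \<in> A" "y = z #> inv x" by blast
    then obtain g where "z = \<Gamma> #> g"
      using sets.sets_into_space[OF assms] by (auto elim!: mY_cases)
    then show "y \<in> {y \<in> space mY. y #> x \<in> A}"
      using z by (simp add: coset_mult_assoc carrier_UNIV rcoset_in_mY m_assoc)
  qed
  then show ?thesis
    using mY assms by (simp add: invariant_prob_def)
qed

text \<open>By Lindelof, countably many right translates of \<open>U\<close> cover the group. Their
  projections are translates of one set; if that set were null, the whole probability space would be
  null.\<close>

lemma emeasure_rcoset_image_pos:
  assumes U: "open U" "U \<noteq> {}"
  shows "emeasure mY ((\<lambda>g. \<Gamma> #> g) ` U) > 0"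
proof (rule ccontr)
  let ?pU = "(\<lambda>g. \<Gamma> #> g) ` U"
  assume "\<not> 0 < emeasure mY ?pU"
  then have null: "emeasure mY ?pU = 0" by simp
  have "open V" if "V \<in> range (\<lambda>x. U #> x)" for V
    using that open_r_coset[OF U(1)] by auto
  then obtain \<F> where \<F>: "\<F> \<subseteq> range (\<lambda>x. U #> x)" "countable \<F>" "\<Union>\<F> = \<Union>(range (\<lambda>x. U #> x))"
    by (rule Lindelof)
  then obtain C where C: "countable C" "(\<Union>x\<in>C. U #> x) = (\<Union>x. U #> x)"
    unfolding countable_subset_image[of \<F>] by (metis countable_subset_image)
  obtain u where u: "u \<in> U" using U(2) by blast
  have "y \<in> (\<Union>x\<in>C. {y \<in> space mY. y #> inv x \<in> ?pU})" if y: "y \<in> space mY" for y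
  proof -
    obtain g where g: "y = \<Gamma> #> g" using y by (rule mY_cases)
    \<comment> \<open>The translate that moves \<open>u\<close> to \<open>g\<close> contains
      \<open>g\<close>, so the translates cover the group.\<close>
    have "g \<in> U #> (inv u \<otimes> g)"
      using u by (simp add: mem_r_coset inv_mult_group m_assoc[symmetric])
    then obtain x where x: "x \<in> C" "g \<in> U #> x" using C(2) by blast
    then have "y #> inv x \<in> ?pU"
      by (auto simp: g coset_mult_assoc carrier_UNIV mem_r_coset)
    then show ?thesis using x y by blast
  qed
  then have "space mY = (\<Union>x\<in>C. {y \<in> space mY. y #> inv x \<in> ?pU})" by blast
  moreover have "{y \<in> space mY. y #> inv x \<in> ?pU} \<in> null_sets mY" for x
  proof
    show "{y \<in> space mY. y #> inv x \<in> ?pU} \<in> sets mY"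
    proof -
      have "(\<lambda>y. (y, inv x)) \<in> measurable mY (mY \<Otimes>\<^sub>M borel)" by simp
      from measurable_compose[OF this measurable_right_action[OF \<Gamma> sets_mY]]
      have "(\<lambda>y. y #> inv x) \<in> measurable mY mY" by simp
      from measurable_sets[OF this rcoset_image_in_sets[OF U(1)]] show ?thesis
        by (simp add: vimage_def Int_def conj_commute)
    qed
    show "emeasure mY {y \<in> space mY. y #> inv x \<in> ?pU} = 0"
      using null rcoset_image_in_sets[OF U(1)] by (simp add: emeasure_mY_translate)
  qed
  ultimately have "space mY \<in> null_sets mY"
    using null_sets_UN'[OF C(1), of "\<lambda>x. {y \<in> space mY. y #> inv x \<in> ?pU}" mY] by simp
  then show False
    using prob_space.emeasure_space_1[OF prob_space_mY] by auto
qed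

text \<open>Both sides are the product measure of the pairs with \<open>x \<in> B\<close> and
  \<open>y #> x \<in> A\<close>. For fixed \<open>x\<close> the slice in \<open>y\<close> has
  measure \<open>emeasure mY A\<close> by invariance; the right side slices the other way.\<close>

lemma emeasure_times_quotient_measure:
  assumes M: "sets M = sets borel" "sigma_finite_measure M"
    and A: "A \<in> sets mY" and B: "B \<in> sets borel"
  shows "emeasure M B * emeasure mY A = (\<integral>\<^sup>+y. emeasure M {x \<in> B. y #> x \<in> A} \<partial>mY)"
proof -
  interpret Y: prob_space mY by (rule prob_space_mY)
  interpret M: sigma_finite_measure M by (rule M(2))
  interpret P: pair_sigma_finite mY M ..
  have spM: "space M = UNIV"
    using sets_eq_imp_space_eq[OF M(1)] by simp
  let ?X = "{z \<in> space (mY \<Otimes>\<^sub>M M). snd z \<in> B \<and> fst z #> snd z \<in> A}"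
  have act: "(\<lambda>z. fst z #> snd z) \<in> measurable (mY \<Otimes>\<^sub>M M) mY"
    using measurable_right_action[OF \<Gamma> sets_mY] 
    by (simp add: split_beta' measurable_cong_sets[OF sets_pair_measure_cong[OF refl M(1)] refl])
  have B': "B \<in> sets M" using B M(1) by simp
  have X: "?X \<in> sets (mY \<Otimes>\<^sub>M M)"
    using act B' A by measurable
  have "emeasure (mY \<Otimes>\<^sub>M M) ?X = (\<integral>\<^sup>+y. emeasure M {x \<in> B. y #> x \<in> A} \<partial>mY)"
    unfolding M.emeasure_pair_measure_alt[OF X]
    by (intro nn_integral_cong arg_cong2[where f = emeasure]) (auto simp: space_pair_measure spM)
  moreover have "emeasure (mY \<Otimes>\<^sub>M M) ?X = (\<integral>\<^sup>+x. emeasure mY A * indicator B x \<partial>M)"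
    unfolding P.emeasure_pair_measure_alt2[OF X]
  proof (intro nn_integral_cong)
    fix x
    have "(\<lambda>y. (y, x)) -` ?X = (if x \<in> B then {y \<in> space mY. y #> x \<in> A} else {})"
      by (auto simp: space_pair_measure spM)
    then show "emeasure mY ((\<lambda>y. (y, x)) -` ?X) = emeasure mY A * indicator B x"
      using emeasure_mY_translate[OF A, of x] by simp
  qed
  ultimately show ?thesis
    using B' by (simp add: nn_integral_cmult_indicator mult.commute[of "emeasure M B"])
qed

text \<open>No proportionality between \<open>mG\<close> and the lift of \<open>mY\<close> is needed: averaging the
  invariance of \<open>mY\<close> over \<open>mG\<close> already compares the two up to constants.\<close>

lemma haar_null_if_quotient_null:
  assumes mG: "haar_measure G UNIV mG" and N: "N \<in> null_sets mY"
  shows "{g. \<Gamma> #> g \<in> N} \<in> null_sets mG"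
proof -
  interpret Y: prob_space mY by (rule prob_space_mY)
  have sets: "sets mG = sets borel"
    using mG by (simp add: haar_measure_def)
  have N': "N \<in> sets mY" "emeasure mY N = 0" using N by auto
  have meas: "{g. \<Gamma> #> g \<in> N} \<in> sets borel"
    using measurable_sets[OF measurable_right_quotient[OF sets_mY] N'(1)]
    by (simp add: vimage_def)
  \<comment> \<open>Left invariance of \<open>mG\<close> makes this volume independent of
    \<open>y\<close>, so integrating it over a probability space returns the volume itself.\<close>
  have "emeasure mG {x. y #> x \<in> N} = emeasure mG {g. \<Gamma> #> g \<in> N}" if "y \<in> space mY" for y
  proof -
    obtain k where k: "y = \<Gamma> #> k" using \<open>y \<in> space mY\<close> by (rule mY_cases)
    have "{x. y #> x \<in> N} = inv k <# {g. \<Gamma> #> g \<in> N}"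
      by (auto simp: k mem_l_coset coset_mult_assoc carrier_UNIV)
    then show ?thesis
      using emeasure_haar_UNIV[OF mG meas] by simp
  qed
  then have "emeasure mG {g. \<Gamma> #> g \<in> N} = (\<integral>\<^sup>+y. emeasure mG {x. y #> x \<in> N} \<partial>mY)"
    by (simp add: Y.emeasure_space_1 cong: nn_integral_cong)
  also have "\<dots> = 0"
    using emeasure_times_quotient_measure[OF sets sigma_finite_haar_measure[OF closed_UNIV mG] N'(1), of UNIV] N'(2)
    by simp
  finally show ?thesis
    using meas sets by (simp add: null_sets_def)
qed

text \<open>Apply the product formula with \<open>B\<close> the set of products of inverses from
  \<open>C\<close> with elements of \<open>K\<close>. For \<open>k\<close> in \<open>U\<close>,
  every point of \<open>inv k <# E\<close> lies in \<open>B\<close> and carries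
  \<open>\<Gamma> #> k\<close> into the image of \<open>E\<close>, so the integral is at least the
  mass of the image of \<open>U\<close> times \<open>emeasure mG E\<close>.\<close>

lemma quotient_measure_lower_bound:
  assumes mG: "haar_measure G UNIV mG" and K: "compact K"
  obtains c :: real where "c > 0"
    "\<And>E. open E \<Longrightarrow> E \<subseteq> K \<Longrightarrow> ennreal c * emeasure mG E \<le> emeasure mY ((\<lambda>g. \<Gamma> #> g) ` E)"
proof -
  interpret Y: prob_space mY by (rule prob_space_mY)
  have sets: "sets mG = sets borel"
    using mG by (simp add: haar_measure_def)
  obtain U C where U: "open U" "compact C" "\<one> \<in> U" "U \<subseteq> C"
    by (rule compact_neighbourhood)
  define B where "B = (\<lambda>(x, y). x \<otimes> y) ` ((\<lambda>x. inv x) ` C \<times> K)"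
  have "compact B"
    unfolding B_def using U(2) K
    by (intro compact_continuous_image compact_Times continuous_on_subset[OF continuous_mult]
        continuous_on_subset[OF continuous_inv]) auto
  then have B: "B \<in> sets borel" "emeasure mG B < \<infinity>"
    using mG by (auto simp: borel_compact haar_measure_def)
  define u where "u = measure mY ((\<lambda>g. \<Gamma> #> g) ` U)"
  \<comment> \<open>Adding 1 keeps \<open>b\<close> positive even when \<open>B\<close> is null, so
    \<open>u / b\<close> is a valid constant.\<close>
  define b where "b = measure mG B + 1"
  have "u > 0"
    using emeasure_rcoset_image_pos[OF U(1)] U(3) unfolding u_def
    by (auto simp: Y.emeasure_eq_measure)
  have "b > 0" unfolding b_def by (simp add: add_nonneg_pos)
  have le: "ennreal u * emeasure mG E \<le> ennreal b * emeasure mY ((\<lambda>g. \<Gamma> #> g) ` E)"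
    if E: "open E" "E \<subseteq> K" for E
  proof -
    let ?pE = "(\<lambda>g. \<Gamma> #> g) ` E" and ?pU = "(\<lambda>g. \<Gamma> #> g) ` U"
    have "ennreal u * emeasure mG E = (\<integral>\<^sup>+y. emeasure mG E * indicator ?pU y \<partial>mY)"
      using rcoset_image_in_sets[OF U(1)]
      by (simp add: nn_integral_cmult_indicator u_def Y.emeasure_eq_measure mult.commute)
    also have "\<dots> \<le> (\<integral>\<^sup>+y. emeasure mG {x \<in> B. y #> x \<in> ?pE} \<partial>mY)"
    proof (intro nn_integral_mono)
      fix y assume y: "y \<in> space mY"
      show "emeasure mG E * indicator ?pU y \<le> emeasure mG {x \<in> B. y #> x \<in> ?pE}"
      proof (cases "y \<in> ?pU")
        case True
        then obtain k where k: "k \<in> U" "y = \<Gamma> #> k" by blast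
        have "inv k <# E \<subseteq> {x \<in> B. y #> x \<in> ?pE}"
        proof
          fix x assume "x \<in> inv k <# E"
          then have x: "k \<otimes> x \<in> E" by (simp add: mem_l_coset)
          have "(inv k, k \<otimes> x) \<in> (\<lambda>x. inv x) ` C \<times> K"
            using x E(2) k U(4) by blast
          then have "x \<in> B"
            unfolding B_def by (rule rev_image_eqI) simp
          then show "x \<in> {x \<in> B. y #> x \<in> ?pE}"
            using x by (auto simp: k(2) coset_mult_assoc carrier_UNIV)
        qed
        moreover have "{x \<in> B. y #> x \<in> ?pE} \<in> sets mG"
        proof -
          have "{x. y #> x \<in> ?pE} = inv k <# {g. \<Gamma> #> g \<in> ?pE}"
            by (auto simp: k mem_l_coset coset_mult_assoc carrier_UNIV)
          moreover have "{g. \<Gamma> #> g \<in> ?pE} \<in> sets borel"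
            using measurable_sets[OF measurable_right_quotient[OF sets_mY] rcoset_image_in_sets[OF E(1)]]
            by (simp add: vimage_def)
          ultimately have "{x. y #> x \<in> ?pE} \<in> sets borel"
            by (simp add: borel_l_coset)
          from sets.Int[OF B(1) this] show ?thesis
            using sets by (simp add: Int_def)
        qed
        ultimately have "emeasure mG (inv k <# E) \<le> emeasure mG {x \<in> B. y #> x \<in> ?pE}"
          by (rule emeasure_mono)
        then show ?thesis
          using True emeasure_haar_UNIV[OF mG borel_open[OF E(1)]] by simp
      qed simp
    qed
    also have "\<dots> = emeasure mG B * emeasure mY ?pE"
      using emeasure_times_quotient_measure[OF sets sigma_finite_haar_measure[OF closed_UNIV mG]
          rcoset_image_in_sets[OF E(1)] B(1)] ..
    also have "\<dots> \<le> ennreal b * emeasure mY ?pE"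
      using B(2) by (intro mult_right_mono) (auto simp: b_def emeasure_eq_ennreal_measure)
    finally show ?thesis .
  qed
  show thesis
  proof (rule that)
    show "u / b > 0" using \<open>u > 0\<close> \<open>b > 0\<close> by simp
    fix E assume E: "open E" "E \<subseteq> K"
    have "ennreal (u / b) * emeasure mG E = ennreal (inverse b) * (ennreal u * emeasure mG E)"
      using \<open>u > 0\<close> \<open>b > 0\<close> by (simp add: mult.assoc[symmetric] ennreal_mult[symmetric] field_simps)
    also have "\<dots> \<le> ennreal (inverse b) * (ennreal b * emeasure mY ((\<lambda>g. \<Gamma> #> g) ` E))"
      by (intro mult_left_mono le E) simp
    also have "\<dots> = emeasure mY ((\<lambda>g. \<Gamma> #> g) ` E)"
      using \<open>b > 0\<close> by (simp add: mult.assoc[symmetric] ennreal_mult[symmetric])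
    finally show "ennreal (u / b) * emeasure mG E \<le> emeasure mY ((\<lambda>g. \<Gamma> #> g) ` E)" .
  qed
qed

end


section \<open>Fibres of the left quotient\<close>

context
  fixes H :: "'g set" and mG mH :: "'g measure" and mX :: "'g set measure"
  assumes H: "subgroup H G" "closed H"
    and mG: "haar_measure G UNIV mG" and mH: "haar_measure G H mH"
    and mX: "quotient_measure G H mG mH mX"
begin

text \<open>This is the inner integral of the quotient formula at an indicator, taken as a function
  on the group. Values are in \<open>ennreal\<close> since open sets may have fibres of infinite
  volume.\<close>

definition fibre_volume :: "'g set \<Rightarrow> 'g \<Rightarrow> ennreal"
  where "fibre_volume A g = emeasure mH {h \<in> H. g \<otimes> h \<in> A}"

lemma sets_mX: "sets mX = sets (borel_of (left_quotient G H))"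
  using mX by (simp add: quotient_measure_def)

lemma space_mX: "space mX = range (\<lambda>g. g <# H)"
  using sets_eq_imp_space_eq[OF sets_mX]
  by (simp add: space_borel_of left_quotient_def topspace_quotient_top)

lemma fibre_in_sets:
  assumes "A \<in> sets borel"
  shows "{h \<in> H. g \<otimes> h \<in> A} \<in> sets mH"
proof -
  have "{h \<in> H. g \<otimes> h \<in> A} = H \<inter> (inv g <# A)"
    by (auto simp: mem_l_coset)
  then show ?thesis
    using sets.Int[OF borel_closed[OF H(2)] borel_l_coset[OF assms, of "inv g"]] H(2)
    by (simp add: haar_measure_sets_iff[OF mH] borel_closed)
qed

text \<open>The element \<open>inv g \<otimes> k\<close> of \<open>H\<close> translates one fibre
  onto the other, and \<open>mH\<close> is left invariant.\<close>

lemma fibre_volume_coset: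
  assumes A: "A \<in> sets borel" and eq: "g <# H = k <# H"
  shows "fibre_volume A g = fibre_volume A k"
proof -
  have h: "inv g \<otimes> k \<in> H"
    using eq lcoset_eq_iff[OF H(1)] by blast
  have "(inv g \<otimes> k) <# {h \<in> H. k \<otimes> h \<in> A} = {h \<in> H. g \<otimes> h \<in> A}"
  proof (intro equalityI subsetI)
    fix x assume "x \<in> (inv g \<otimes> k) <# {h \<in> H. k \<otimes> h \<in> A}"
    then have x: "inv (inv g \<otimes> k) \<otimes> x \<in> H" "g \<otimes> x \<in> A"
      by (simp_all add: mem_l_coset inv_mult_group m_assoc)
    have "(inv g \<otimes> k) \<otimes> (inv (inv g \<otimes> k) \<otimes> x) \<in> H"
      by (rule subgroup.m_closed[OF H(1) h x(1)])
    with x(2) show "x \<in> {h \<in> H. g \<otimes> h \<in> A}"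
      by simp
  next
    fix x assume x: "x \<in> {h \<in> H. g \<otimes> h \<in> A}"
    then have "inv (inv g \<otimes> k) \<otimes> x \<in> H"
      using h H(1) by (simp add: subgroup.m_closed subgroup.m_inv_closed)
    then show "x \<in> (inv g \<otimes> k) <# {h \<in> H. k \<otimes> h \<in> A}"
      using x by (simp add: mem_l_coset inv_mult_group m_assoc)
  qed
  moreover have "emeasure mH ((inv g \<otimes> k) <# {h \<in> H. k \<otimes> h \<in> A}) = emeasure mH {h \<in> H. k \<otimes> h \<in> A}"
    by (rule emeasure_haar_l_coset[OF mH h fibre_in_sets[OF A]])
  ultimately show ?thesis
    by (simp add: fibre_volume_def)
qed

lemma fibre_volume_representative:
  assumes "A \<in> sets borel"
  shows "fibre_volume A (SOME k. k \<in> g <# H) = fibre_volume A g"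
proof (rule fibre_volume_coset[OF assms])
  have "g \<in> g <# H"
    using H(1) by (simp add: mem_l_coset subgroup.one_closed)
  then have "(SOME k. k \<in> g <# H) \<in> g <# H"
    by (rule someI)
  then have "g <# H = (SOME k. k \<in> g <# H) <# H"
    by (simp only: lcoset_eq_iff[OF H(1)] mem_l_coset)
  then show "(SOME k. k \<in> g <# H) <# H = g <# H"
    by (rule sym)
qed

lemma emeasure_mG_fibres:
  assumes A: "A \<in> sets borel"
  shows "emeasure mG A = (\<integral>\<^sup>+x. fibre_volume A (SOME g. g \<in> x) \<partial>mX)"
proof -
  have "A \<in> sets mG"
    using A mG by (simp add: haar_measure_def)
  then have "emeasure mG A = (\<integral>\<^sup>+g. indicator A g \<partial>mG)"
    by simp
  also have "\<dots> = (\<integral>\<^sup>+x. (\<integral>\<^sup>+h. indicator A ((SOME g. g \<in> x) \<otimes> h) \<partial>mH) \<partial>mX)"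
  proof -
    have "(indicator A :: 'g \<Rightarrow> ennreal) \<in> borel_measurable borel"
      using A by simp
    moreover have "\<forall>f\<in>borel_measurable borel.
        (\<integral>\<^sup>+g. f g \<partial>mG) = (\<integral>\<^sup>+x. (\<integral>\<^sup>+h. f ((SOME g. g \<in> x) \<otimes> h) \<partial>mH) \<partial>mX)"
      using mX by (simp add: quotient_measure_def)
    ultimately show ?thesis
      by (rule bspec[rotated])
  qed
  also have "\<dots> = (\<integral>\<^sup>+x. fibre_volume A (SOME g. g \<in> x) \<partial>mX)"
  proof (rule nn_integral_cong)
    fix x :: "'g set"
    let ?g = "SOME g. g \<in> x"
    have "(\<integral>\<^sup>+h. indicator A (?g \<otimes> h) \<partial>mH) = (\<integral>\<^sup>+h. indicator {h \<in> H. ?g \<otimes> h \<in> A} h \<partial>mH)"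
      by (intro nn_integral_cong) (auto simp: indicator_def space_haar_measure[OF mH])
    also have "\<dots> = fibre_volume A ?g"
      using fibre_in_sets[OF A] by (simp add: fibre_volume_def)
    finally show "(\<integral>\<^sup>+h. indicator A (?g \<otimes> h) \<partial>mH) = fibre_volume A ?g" .
  qed
  finally show ?thesis .
qed

section \<open>Measurability of fibre volumes\<close>

text \<open>The fibre over \<open>g\<close> is the part of \<open>H\<close> in the union of those
  \<open>B n\<close> with \<open>g \<in> A n\<close>. By continuity from below its volume exceeds
  \<open>c\<close> exactly when finitely many such \<open>n\<close> already suffice, and membership
  in finitely many \<open>A n\<close> is an open condition.\<close>

lemma open_fibre_volume_greater:
  assumes "open U"
  shows "open {g. c < fibre_volume U g}"
proof -
  obtain A B where AB: "\<And>n. open (A n)" "\<And>n. open (B n)"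
    "\<And>x y. x \<otimes> y \<in> U \<longleftrightarrow> (\<exists>n::nat. x \<in> A n \<and> y \<in> B n)"
    by (rule open_mult_countable_rectangles[OF assms]) blast
  define V where "V S = H \<inter> (\<Union>n\<in>S. B n)" for S
  have V: "V S \<in> sets mH" for S
    unfolding V_def using H(2) AB(2)
    by (simp add: haar_measure_sets_iff[OF mH] borel_closed borel_open open_UN)
  have fibre: "{h \<in> H. g \<otimes> h \<in> U} = V {n. g \<in> A n}" for g
    using AB(3) by (auto simp: V_def)
  have "{g. c < fibre_volume U g} = (\<Union>S\<in>{S. finite S \<and> c < emeasure mH (V S)}. \<Inter>n\<in>S. A n)"
    (is "?L = ?R")
  proof (intro equalityI subsetI)
    fix g assume "g \<in> ?L"
    then have g: "c < emeasure mH (V {n. g \<in> A n})"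
      by (simp add: fibre_volume_def fibre)
    define T where "T k = {n. g \<in> A n} \<inter> {..<k::nat}" for k
    have "incseq (\<lambda>k. V (T k))"
      by (rule incseq_SucI) (auto simp: T_def V_def)
    moreover have "(\<Union>k. V (T k)) = V {n. g \<in> A n}"
      by (auto simp: T_def V_def)
    ultimately have "emeasure mH (V {n. g \<in> A n}) = (SUP k. emeasure mH (V (T k)))"
      using SUP_emeasure_incseq[of "\<lambda>k. V (T k)" mH] V by (simp add: image_subset_iff)
    then obtain k where "c < emeasure mH (V (T k))"
      using g by (auto simp: less_SUP_iff)
    then show "g \<in> ?R"
      by (auto simp: T_def intro!: bexI[of _ "T k"] exI[of _ "T k"])
  next
    fix g assume "g \<in> ?R"
    then obtain S where S: "c < emeasure mH (V S)" "S \<subseteq> {n. g \<in> A n}"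
      by blast
    have "emeasure mH (V S) \<le> emeasure mH (V {n. g \<in> A n})"
      using S(2) V by (intro emeasure_mono) (auto simp: V_def)
    then show "g \<in> ?L"
      using S(1) by (simp add: fibre_volume_def fibre)
  qed
  also have "open \<dots>"
    using AB(1) by (intro open_UN ballI) (auto intro!: open_INT)
  finally show ?thesis .
qed

text \<open>A superlevel set in the quotient is the image of an open set under the open
  projection.\<close>

lemma measurable_fibre_volume_open:
  assumes U: "open U"
  shows "(\<lambda>x. fibre_volume U (SOME g. g \<in> x)) \<in> borel_measurable mX"
proof (rule borel_measurableI_greater)
  fix c
  have "{x \<in> space mX. c < fibre_volume U (SOME g. g \<in> x)} = (\<lambda>g. g <# H) ` {g. c < fibre_volume U g}"
    using fibre_volume_representative[OF borel_open[OF U]] by (auto simp: space_mX)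
  then show "{x \<in> space mX. c < fibre_volume U (SOME g. g \<in> x)} \<in> sets mX"
    unfolding sets_mX
    by (simp add: openin_sets_borel_of openin_left_quotient_image[OF H(1)] open_fibre_volume_greater[OF U])
qed

text \<open>Borel sections of \<open>G \<rightarrow> G/H\<close> are avoided: fibre volumes of open sets are lower
  semicontinuous, and Borel subsets of a set with finite fibre volumes follow by Dynkin's lemma.\<close>

lemma measurable_fibre_volume:
  assumes V: "open V" "V \<subseteq> K" "compact K" and A: "A \<in> sets borel"
  shows "(\<lambda>x. fibre_volume (A \<inter> V) (SOME g. g \<in> x)) \<in> borel_measurable mX"
proof -
  \<comment> \<open>Fibres of a precompact set lie in compact pieces of \<open>H\<close>. Finiteness
    is what allows the complement case to subtract volumes.\<close>
  have fin: "fibre_volume V g < \<infinity>" for g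
  proof -
    have "{h \<in> H. g \<otimes> h \<in> V} \<subseteq> H \<inter> (inv g <# K)"
      using V(2) by (auto simp: mem_l_coset)
    then have "fibre_volume V g \<le> emeasure mH (H \<inter> (inv g <# K))"
      unfolding fibre_volume_def using H(2) V(3)
      by (intro emeasure_mono) (auto simp: haar_measure_sets_iff[OF mH] borel_closed borel_compact compact_l_coset)
    also have "\<dots> < \<infinity>"
      by (intro emeasure_haar_compact[OF H(2) mH] compact_l_coset V)
    finally show ?thesis .
  qed
  have "Int_stable {S::'g set. open S}"
    by (auto simp: Int_stable_def)
  moreover have "{S::'g set. open S} \<subseteq> Pow UNIV"
    by simp
  moreover have "A \<in> sigma_sets UNIV {S. open S}"
    using A by (simp add: sets_borel)
  ultimately show ?thesis
  proof (induction rule: sigma_sets_induct_disjoint)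
    case (basic A)
    then show ?case
      using V(1) by (intro measurable_fibre_volume_open) auto
  next
    case empty
    then show ?case by (simp add: fibre_volume_def)
  next
    case (compl A)
    then have A: "A \<in> sets borel" by (simp add: sets_borel)
    have "fibre_volume ((UNIV - A) \<inter> V) g = fibre_volume V g - fibre_volume (A \<inter> V) g" for g
    proof -
      have "{h \<in> H. g \<otimes> h \<in> (UNIV - A) \<inter> V} = {h \<in> H. g \<otimes> h \<in> V} - {h \<in> H. g \<otimes> h \<in> A \<inter> V}"
        by blast
      moreover have "fibre_volume (A \<inter> V) g \<le> fibre_volume V g"
        unfolding fibre_volume_def
        by (intro emeasure_mono fibre_in_sets borel_open V) auto
      ultimately show ?thesis
        using fin[of g] V(1) A unfolding fibre_volume_def
        by (subst emeasure_Diff[symmetric])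
          (simp_all add: fibre_in_sets less_imp_neq del: Int_iff, blast)
    qed
    then show ?case
      using compl measurable_fibre_volume_open[OF V(1)] by simp
  next
    case (union A)
    then have A: "A i \<in> sets borel" for i
      using union(2) by (auto simp: sets_borel)
    have "fibre_volume (\<Union> (range A) \<inter> V) g = (\<Sum>i. fibre_volume (A i \<inter> V) g)" for g
    proof -
      have "{h \<in> H. g \<otimes> h \<in> \<Union> (range A) \<inter> V} = (\<Union>i. {h \<in> H. g \<otimes> h \<in> A i \<inter> V})"
        by blast
      moreover have "disjoint_family (\<lambda>i. {h \<in> H. g \<otimes> h \<in> A i \<inter> V})"
        using union(1) by (auto simp: disjoint_family_on_def)
      ultimately show ?thesis
        using A V(1) unfolding fibre_volume_def
        by (subst suminf_emeasure) (simp_all add: image_subset_iff fibre_in_sets del: Int_iff)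
    qed
    then show ?case
      using union(3) by simp
  qed
qed

section \<open>Null sets and open sets seen through their fibres\<close>

text \<open>By the quotient formula a null set has null fibres over almost every coset, whereas a
  coset contained in \<open>A\<close> has all of \<open>H\<close> as fibre, which has positive
  measure. Cutting \<open>A\<close> by the precompact cover supplies the measurability needed to
  pass from a zero integral to a vanishing integrand.\<close>

lemma AE_coset_avoids_null:
  assumes A: "A \<in> null_sets mG"
  shows "AE x in mX. \<exists>g\<in>x. g \<notin> A"
proof -
  have A': "A \<in> sets borel"
    using A mG by (auto simp: haar_measure_def)
  obtain \<U> :: "'g set set" where \<U>: "countable \<U>"
    "\<And>U. U \<in> \<U> \<Longrightarrow> open U \<and> (\<exists>K. compact K \<and> U \<subseteq> K)" "\<Union>\<U> = UNIV"
    by (rule countable_precompact_cover) blast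
  have "AE x in mX. fibre_volume (A \<inter> U) (SOME g. g \<in> x) = 0" if U: "U \<in> \<U>" for U
  proof -
    obtain K where K: "open U" "U \<subseteq> K" "compact K"
      using \<U>(2)[OF U] by blast
    have "A \<inter> U \<in> null_sets mG"
      using A K(1) mG by (intro null_set_Int2) (auto simp: haar_measure_def)
    then have "(\<integral>\<^sup>+x. fibre_volume (A \<inter> U) (SOME g. g \<in> x) \<partial>mX) = 0"
      using emeasure_mG_fibres[of "A \<inter> U"] A' K(1) by auto
    then show ?thesis
      using measurable_fibre_volume[OF K A'] by (simp add: nn_integral_0_iff_AE)
  qed
  then have "AE x in mX. \<forall>U\<in>\<U>. fibre_volume (A \<inter> U) (SOME g. g \<in> x) = 0"
    using \<U>(1) by (simp add: AE_ball_countable)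
  moreover have "\<exists>g\<in>x. g \<notin> A"
    if x: "x \<in> space mX" and null: "\<forall>U\<in>\<U>. fibre_volume (A \<inter> U) (SOME g. g \<in> x) = 0" for x
  proof (rule ccontr)
    assume "\<not> (\<exists>g\<in>x. g \<notin> A)"
    then have sub: "x \<subseteq> A" by blast
    obtain g where g: "x = g <# H"
      using x by (auto simp: space_mX)
    have "g \<otimes> h \<in> A" if "h \<in> H" for h
      using sub that by (auto simp: g l_coset_def)
    moreover have "\<exists>U\<in>\<U>. k \<in> U" for k
      using \<U>(3) by blast
    ultimately have "H = (\<Union>U\<in>\<U>. {h \<in> H. g \<otimes> h \<in> A \<inter> U})"
      by auto
    moreover have "{h \<in> H. g \<otimes> h \<in> A \<inter> U} \<in> null_sets mH" if "U \<in> \<U>" for U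
    proof
      have m: "A \<inter> U \<in> sets borel"
        using A' \<U>(2)[OF that] by auto
      show "{h \<in> H. g \<otimes> h \<in> A \<inter> U} \<in> sets mH"
        by (rule fibre_in_sets[OF m])
      show "emeasure mH {h \<in> H. g \<otimes> h \<in> A \<inter> U} = 0"
        using null that fibre_volume_representative[OF m, of g] by (simp add: g fibre_volume_def)
    qed
    ultimately have "H \<in> null_sets mH"
      using null_sets_UN'[OF \<U>(1), of "\<lambda>U. {h \<in> H. g \<otimes> h \<in> A \<inter> U}" mH] by simp
    moreover have "UNIV \<inter> H \<noteq> {}"
      using subgroup.one_closed[OF H(1)] by blast
    then have "emeasure mH (UNIV \<inter> H) > 0"
      using mH unfolding haar_measure_def by (metis open_UNIV)
    ultimately show False by auto
  qed
  ultimately show ?thesis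
    by (auto elim!: AE_mp)
qed

text \<open>Multiplication sends some \<open>A n \<times> B n\<close> around
  \<open>(g, \<one>)\<close> into a precompact \<open>U\<close>. With \<open>W = A n\<close> and
  \<open>E\<close> the part of \<open>U\<close> above the given open set, each fibre of
  \<open>E\<close> over that set contains a translate of \<open>B n \<inter> H\<close>, up to the
  choice of representative, so its volume has a uniform positive lower bound.\<close>

lemma open_lift:
  obtains W K :: "'g set" and c :: real where "open W" "g \<in> W" "compact K" "c > 0"
    "\<And>B. openin (left_quotient G H) B \<Longrightarrow> B \<subseteq> (\<lambda>g. g <# H) ` W \<Longrightarrow>
      \<exists>E. open E \<and> E \<subseteq> K \<and> (\<forall>g\<in>E. g <# H \<in> B) \<and> ennreal c * emeasure mX B \<le> emeasure mG E"
proof -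
  obtain U K where U: "open U" "compact K" "g \<in> U" "U \<subseteq> K"
    by (rule compact_neighbourhood)
  obtain A B where AB: "\<And>n. open (A n)" "\<And>n. open (B n)"
    "\<And>x y. x \<otimes> y \<in> U \<longleftrightarrow> (\<exists>n::nat. x \<in> A n \<and> y \<in> B n)"
    by (rule open_mult_countable_rectangles[OF U(1)]) blast
  have "g \<otimes> \<one> \<in> U"
    using U(3) by simp
  then obtain n where n: "g \<in> A n" "\<one> \<in> B n"
    using AB(3) by blast
  have "B n \<inter> H \<noteq> {}"
    using n(2) subgroup.one_closed[OF H(1)] by blast
  then have pos: "0 < emeasure mH (B n \<inter> H)"
    using mH AB(2)[of n] by (simp add: haar_measure_def)
  \<comment> \<open>Capping at 1 yields a real constant without estimating the volume of
    \<open>B n \<inter> H\<close> from above.\<close>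
  define c where "c = enn2real (min 1 (emeasure mH (B n \<inter> H)))"
  have c: "ennreal c = min 1 (emeasure mH (B n \<inter> H))"
    unfolding c_def by (rule ennreal_enn2real) (simp add: min_less_iff_disj)
  show thesis
  proof (rule that)
    show "open (A n)" "g \<in> A n" "compact K"
      using AB n U by auto
    have "0 < ennreal c"
      using pos unfolding c by simp
    then show "c > 0" by (simp add: ennreal_less_zero_iff)
    fix Q assume Q: "openin (left_quotient G H) Q" "Q \<subseteq> (\<lambda>g. g <# H) ` A n"
    define E where "E = U \<inter> (\<lambda>g. g <# H) -` Q"
    have E: "open E"
      using Q(1) U(1) by (simp add: E_def left_quotient_def openin_quotient_top open_Int)
    have Q': "Q \<in> sets mX"
      using Q(1) by (simp add: sets_mX openin_sets_borel_of)
    have "ennreal c * emeasure mX Q = (\<integral>\<^sup>+x. ennreal c * indicator Q x \<partial>mX)"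
      using Q' by (simp add: nn_integral_cmult_indicator)
    also have "\<dots> \<le> (\<integral>\<^sup>+x. fibre_volume E (SOME g. g \<in> x) \<partial>mX)"
    proof (intro nn_integral_mono)
      fix x
      show "ennreal c * indicator Q x \<le> fibre_volume E (SOME g. g \<in> x)"
      proof (cases "x \<in> Q")
        case True
        then obtain w where w: "w \<in> A n" "x = w <# H"
          using Q(2) by blast
        have "B n \<inter> H \<subseteq> {h \<in> H. w \<otimes> h \<in> E}"
        proof
          fix h assume h: "h \<in> B n \<inter> H"
          then have "(w \<otimes> h) <# H = x"
            using H(1) by (simp add: w(2) lcoset_eq_iff inv_mult_group m_assoc subgroup.m_inv_closed)
          then show "h \<in> {h \<in> H. w \<otimes> h \<in> E}"
            using h True AB(3)[of w h] w(1) by (auto simp: E_def)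
        qed
        then have "emeasure mH (B n \<inter> H) \<le> fibre_volume E w"
          unfolding fibre_volume_def by (intro emeasure_mono fibre_in_sets borel_open E)
        then show ?thesis
          using True fibre_volume_representative[OF borel_open[OF E], of w]
          by (simp add: w(2) c min.coboundedI2)
      qed simp
    qed
    also have "\<dots> = emeasure mG E"
      using emeasure_mG_fibres[OF borel_open[OF E]] ..
    finally show "\<exists>E. open E \<and> E \<subseteq> K \<and> (\<forall>g\<in>E. g <# H \<in> Q) \<and> ennreal c * emeasure mX Q \<le> emeasure mG E"
      using E U(4) by (intro exI[of _ E]) (auto simp: E_def)
  qed
qed

end


section \<open>Hitting a set along averages\<close>

lemma conj_subgroup_one: "conj_subgroup G \<one> H = H"
  by (simp add: conj_subgroup_def)

lemma conj_measure_one: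
  assumes "haar_measure G H mH"
  shows "conj_measure G \<one> H mH = mH"
  using assms by (simp add: conj_measure_def conj_subgroup_one haar_measure_def distr_id2)

section \<open>Measure of the points whose averages miss a set\<close>

context
  fixes H \<Gamma> :: "'g set" and mH :: "'g measure" and mY :: "'g set measure" and D :: "'g \<Rightarrow> real"
  assumes H: "closed H" and mH: "haar_measure G H mH"
    and \<Gamma>: "subgroup \<Gamma> G" and mY: "invariant_prob G \<Gamma> mY"
    and D: "proper_size D"
begin

lemma emeasure_sublevel_finite: "emeasure mH (sublevel D t \<inter> H) < \<infinity>"
proof -
  have "sublevel D t = D -` {0..t}"
    using D by (auto simp: sublevel_def proper_size_def)
  then have "compact (sublevel D t)"
    using D by (simp add: proper_size_def)
  from emeasure_haar_compact[OF H mH this] show ?thesis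
    by (simp add: Int_commute)
qed

lemma sublevel_in_sets: "sublevel D t \<inter> H \<in> sets mH"
proof -
  have "closed (sublevel D t)"
    using D unfolding sublevel_def proper_size_def
    by (intro closed_Collect_le continuous_on_const) auto
  from sets.Int[OF borel_closed[OF this] borel_closed[OF H]] show ?thesis
    using H by (simp add: haar_measure_sets_iff[OF mH] borel_closed)
qed

lemma ball_average_one:
  "ball_average G H mH D \<one> t f y =
    inverse (measure mH (sublevel D t \<inter> H)) *\<^sub>R (LINT h : sublevel D t \<inter> H | mH. f (y #> h))"
  by (simp add: ball_average_def ball_volume_def conj_subgroup_one conj_measure_one[OF mH])

text \<open>The action is jointly measurable, and integrating out the \<sigma>-finite
  \<open>mH\<close> preserves measurability in \<open>y\<close>.\<close>

lemma measurable_ball_average: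
  assumes f: "f \<in> borel_measurable mY"
  shows "ball_average G H mH D \<one> t f \<in> borel_measurable mY"
proof -
  interpret sigma_finite_measure mH
    by (rule sigma_finite_haar_measure[OF H mH])
  have "(\<lambda>h. h) \<in> measurable mH borel"
    using mH measurable_restrict_space1[OF measurable_ident, of borel H]
    by (simp add: haar_measure_def id_def cong: measurable_cong_sets)
  then have "(\<lambda>z. (fst z, snd z)) \<in> measurable (mY \<Otimes>\<^sub>M mH) (mY \<Otimes>\<^sub>M borel)"
    by (intro measurable_Pair measurable_fst measurable_compose[OF measurable_snd])
  from measurable_compose[OF measurable_compose[OF this measurable_right_action[OF \<Gamma> sets_mY[OF \<Gamma> mY]]] f]
  have "(\<lambda>z. f (fst z #> snd z)) \<in> borel_measurable (mY \<Otimes>\<^sub>M mH)"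
    by (simp add: split_beta')
  moreover have "(\<lambda>z. indicator (sublevel D t \<inter> H) (snd z) :: real) \<in> borel_measurable (mY \<Otimes>\<^sub>M mH)"
    using sublevel_in_sets by (intro measurable_compose[OF measurable_snd]) simp
  ultimately have "(\<lambda>(y, h). indicator (sublevel D t \<inter> H) h *\<^sub>R f (y #> h)) \<in> borel_measurable (mY \<Otimes>\<^sub>M mH)"
    by (simp add: split_beta')
  from borel_measurable_lebesgue_integral[OF this]
  have "(\<lambda>y. LINT h : sublevel D t \<inter> H | mH. f (y #> h)) \<in> borel_measurable mY"
    by (simp add: set_lebesgue_integral_def)
  then show ?thesis
    by (simp add: ball_average_one[abs_def])
qed

lemma norm_ball_average_le:
  assumes "\<And>y. cmod (f y) \<le> 1"
  shows "cmod (ball_average G H mH D \<one> t f y) \<le> 1"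
proof -
  have "cmod (LINT h : sublevel D t \<inter> H | mH. f (y #> h))
      \<le> (\<integral>h. cmod (indicator (sublevel D t \<inter> H) h *\<^sub>R f (y #> h)) \<partial>mH)"
    unfolding set_lebesgue_integral_def by (rule integral_norm_bound)
  also have "\<dots> \<le> (\<integral>h. indicator (sublevel D t \<inter> H) h \<partial>mH)"
    using emeasure_sublevel_finite sublevel_in_sets assms
    by (intro integral_mono' integrable_real_indicator) (auto simp: indicator_def)
  also have "\<dots> = measure mH (sublevel D t \<inter> H)"
    using sublevel_in_sets by simp
  finally have "cmod (LINT h : sublevel D t \<inter> H | mH. f (y #> h)) \<le> measure mH (sublevel D t \<inter> H)" .
  \<comment> \<open>A ball of measure zero gives the average 0, since
    \<open>inverse 0 = 0\<close>.\<close>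
  then show ?thesis
    by (cases "measure mH (sublevel D t \<inter> H) = 0")
      (auto simp: ball_average_one field_simps zero_less_measure_iff)
qed

text \<open>\<open>Z\<close> is the zero set of the average of the indicator of \<open>A\<close>. On
  it the deviation from the mean \<open>m\<close> has modulus \<open>m\<close>, while the squared
  norm of the indicator is \<open>m\<close>, so Chebyshev gives
  \<open>m\<^sup>2 * measure mY Z \<le> R\<^sup>2 * m\<close>, and one factor \<open>m\<close>
  cancels.\<close>

lemma missing_set_bound:
  assumes A: "A \<in> sets mY" and pos: "measure mY A > 0"
    and bound: "\<And>f. f \<in> L2 mY \<Longrightarrow>
      L2_norm mY (\<lambda>y. ball_average G H mH D \<one> t f y - (\<integral>z. f z \<partial>mY)) \<le> R * L2_norm mY f"
  shows "\<exists>Z\<in>sets mY. measure mY Z * measure mY A \<le> R\<^sup>2 \<and>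
    (\<forall>y\<in>space mY - Z. \<exists>h\<in>H. D h \<le> t \<and> y #> h \<in> A)"
proof -
  interpret Y: prob_space mY by (rule prob_space_mY[OF \<Gamma> mY])
  define f :: "'g set \<Rightarrow> complex" where "f = indicator A"
  define F where "F = ball_average G H mH D \<one> t f"
  define m where "m = measure mY A"
  have f: "f \<in> borel_measurable mY"
    using A by (simp add: f_def)
  have F: "F \<in> borel_measurable mY"
    unfolding F_def by (rule measurable_ball_average[OF f])
  have normf: "(cmod (f y))\<^sup>2 = indicator A y" for y
    by (simp add: f_def indicator_def)
  have "f \<in> L2 mY"
    using f A by (simp add: L2_def normf Y.emeasure_finite less_top[symmetric])
  moreover have "(\<integral>z. f z \<partial>mY) = complex_of_real m"
  proof -
    have "(\<integral>z. f z \<partial>mY) = (\<integral>z. complex_of_real (indicator A z) \<partial>mY)"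
      by (intro Bochner_Integration.integral_cong) (auto simp: f_def indicator_def)
    also have "\<dots> = complex_of_real (\<integral>z. indicator A z \<partial>mY)"
      by (rule integral_complex_of_real)
    finally show ?thesis
      using A by (simp add: m_def Int_absorb2 sets.sets_into_space)
  qed
  ultimately have "L2_norm mY (\<lambda>y. F y - m) \<le> R * L2_norm mY f"
    using bound[of f] by (simp add: F_def)
  then have "(L2_norm mY (\<lambda>y. F y - m))\<^sup>2 \<le> (R * L2_norm mY f)\<^sup>2"
    by (intro power_mono) (simp_all add: L2_norm_def)
  also have "\<dots> = R\<^sup>2 * m"
    using A by (simp add: L2_norm_def normf power_mult_distrib m_def Int_absorb2 sets.sets_into_space)
  finally have le: "(\<integral>y. (cmod (F y - m))\<^sup>2 \<partial>mY) \<le> R\<^sup>2 * m"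
    by (simp add: L2_norm_def)
  define Z where "Z = {y \<in> space mY. F y = 0}"
  have Z: "Z \<in> sets mY"
    unfolding Z_def using F by measurable
  \<comment> \<open>Boundedness makes the squared deviation integrable, as the comparison of
    integrals below requires.\<close>
  have "cmod (F y - m) \<le> 1 + m" for y
  proof -
    have "cmod (F y) \<le> 1"
      unfolding F_def by (rule norm_ball_average_le) (simp add: f_def indicator_def)
    then show ?thesis
      using norm_triangle_ineq4[of "F y" "complex_of_real m"] by (simp add: m_def)
  qed
  then have int: "integrable mY (\<lambda>y. (cmod (F y - m))\<^sup>2)"
    using F by (intro Y.integrable_const_bound[where B = "(1 + m)\<^sup>2"]) (auto intro!: AE_I2 power_mono)
  have "m\<^sup>2 * measure mY Z = (\<integral>y. m\<^sup>2 * indicator Z y \<partial>mY)"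
    using Z by (simp add: Int_absorb2 sets.sets_into_space)
  also have "\<dots> \<le> (\<integral>y. (cmod (F y - m))\<^sup>2 \<partial>mY)"
    using int by (intro integral_mono') (auto simp: Z_def indicator_def)
  finally have "m * (measure mY Z * m) \<le> m * R\<^sup>2"
    using le by (simp add: power2_eq_square mult_ac)
  then have "measure mY Z * m \<le> R\<^sup>2"
    using pos by (simp add: m_def)
  moreover have "\<exists>h\<in>H. D h \<le> t \<and> y #> h \<in> A" if y: "y \<in> space mY - Z" for y
  proof (rule ccontr)
    assume "\<not> (\<exists>h\<in>H. D h \<le> t \<and> y #> h \<in> A)"
    then have "(\<lambda>h. indicator (sublevel D t \<inter> H) h *\<^sub>R f (y #> h)) = (\<lambda>h. 0)"
      by (auto simp: f_def sublevel_def indicator_def)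
    then have "F y = 0"
      unfolding F_def ball_average_one set_lebesgue_integral_def by simp
    then show False
      using y by (simp add: Z_def)
  qed
  ultimately show ?thesis
    using Z unfolding m_def by blast
qed

end

section \<open>From hits at dyadic radii to the exponent\<close>

text \<open>The lattice element is \<open>g \<otimes> h \<otimes> inv e\<close>. Coarse stability
  costs an additive constant in \<open>D\<close>, and rounding the radius to a power of 2 costs
  another; the gap between \<open>\<zeta>'\<close> and \<open>\<zeta>\<close> absorbs both for small
  radii.\<close>

lemma approx_exponent_le:
  assumes stable: "coarsely_stable G D" and H: "subgroup H G" and \<Gamma>: "subgroup \<Gamma> G"
    and K: "compact K" and \<zeta>: "0 < \<zeta>'" "\<zeta>' < \<zeta>"
    and hits: "\<forall>\<^sub>F n in sequentially. \<exists>h\<in>H. \<exists>e\<in>K. D h \<le> \<zeta>' * real n * ln 2 \<and>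
      \<Gamma> #> (g \<otimes> h) = \<Gamma> #> e \<and> dst (e <# H) x0 \<le> 2 powr (- real n)"
  shows "approx_exponent G \<Gamma> dst D (g <# H) x0 \<le> ereal \<zeta>"
proof -
  \<comment> \<open>One compact set contains both outer factors of every \<open>\<gamma>\<close>, so
    a single \<open>b\<close> serves all scales.\<close>
  have "compact (insert g ((\<lambda>x. inv x) ` K))"
    using K by (intro compact_insert compact_continuous_image continuous_on_subset[OF continuous_inv]) auto
  then obtain b where b: "\<And>u v k. u \<in> insert g ((\<lambda>x. inv x) ` K) \<Longrightarrow> v \<in> insert g ((\<lambda>x. inv x) ` K) \<Longrightarrow>
      D (u \<otimes> k \<otimes> v) \<le> D k + b"
    using stable unfolding coarsely_stable_def by meson
  obtain n0 where n0: "\<And>n. n \<ge> n0 \<Longrightarrow> \<exists>h\<in>H. \<exists>e\<in>K. D h \<le> \<zeta>' * real n * ln 2 \<and>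
      \<Gamma> #> (g \<otimes> h) = \<Gamma> #> e \<and> dst (e <# H) x0 \<le> 2 powr (- real n)"
    using hits by (auto simp: eventually_sequentially)
  \<comment> \<open>The first term forces \<open>n \<ge> n0\<close>; the second makes
    \<open>- ln \<epsilon> * (\<zeta> - \<zeta>')\<close> exceed the accumulated constant
    \<open>\<zeta>' * ln 2 + b\<close>.\<close>
  define L where "L = max (real n0 * ln 2) ((\<zeta>' * ln 2 + b) / (\<zeta> - \<zeta>'))"
  have "\<exists>\<gamma>\<in>\<Gamma>. dst (inv \<gamma> <# (g <# H)) x0 \<le> \<epsilon> \<and> exp (D \<gamma>) \<le> \<epsilon> powr (- \<zeta>)"
    if \<epsilon>: "0 < \<epsilon>" "\<epsilon> < exp (- L)" for \<epsilon>
  proof -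
    have "ln \<epsilon> < - L"
      using \<epsilon> by (metis exp_gt_zero ln_exp ln_less_cancel_iff)
    then have ln1: "real n0 * ln 2 < - ln \<epsilon>" and ln2: "(\<zeta>' * ln 2 + b) / (\<zeta> - \<zeta>') < - ln \<epsilon>"
      by (auto simp: L_def)
    \<comment> \<open>The least \<open>n\<close> with
      \<open>2 powr (- real n) \<le> \<epsilon>\<close>; minimality gives the reverse bound up to a
      factor 2.\<close>
    define n where "n = nat \<lceil>- ln \<epsilon> / ln 2\<rceil>"
    have "0 \<le> real n0 * ln 2" by simp
    then have "0 < - ln \<epsilon>"
      using ln1 by linarith
    then have "0 < - ln \<epsilon> / ln 2"
      by (rule divide_pos_pos) simp
    then have n: "- ln \<epsilon> / ln 2 \<le> real n" "real n < - ln \<epsilon> / ln 2 + 1"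
      unfolding n_def by linarith+
    have n1: "- ln \<epsilon> \<le> real n * ln 2" and n2: "real n * ln 2 < - ln \<epsilon> + ln 2"
      using n by (simp_all add: field_simps)
    have "n \<ge> n0"
      using ln1 n1 by (metis less_le_trans ln_gt_zero mult_less_cancel_right_pos of_nat_less_iff one_less_numeral_iff semiring_norm(76) less_imp_le)
    from n0[OF this] obtain h e where he: "h \<in> H" "e \<in> K" "D h \<le> \<zeta>' * real n * ln 2"
      "\<Gamma> #> (g \<otimes> h) = \<Gamma> #> e" "dst (e <# H) x0 \<le> 2 powr (- real n)"
      by blast
    define \<gamma> where "\<gamma> = g \<otimes> h \<otimes> inv e"
    have "\<gamma> \<in> \<Gamma>"
      using he(4) \<Gamma> by (simp add: \<gamma>_def rcoset_eq_iff)
    \<comment> \<open>Here \<open>inv \<gamma> \<otimes> g = e \<otimes> inv h\<close>, and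
      \<open>inv h\<close> is absorbed by \<open>H\<close>.\<close>
    moreover have "inv \<gamma> <# (g <# H) = e <# H"
    proof -
      have "inv \<gamma> <# (g <# H) = (inv \<gamma> \<otimes> g) <# H"
        by (simp add: lcos_m_assoc carrier_UNIV)
      also have "\<dots> = e <# H"
        using he(1) H
        by (simp add: lcoset_eq_iff \<gamma>_def inv_mult_group m_assoc)
      finally show ?thesis .
    qed
    moreover have "2 powr (- real n) \<le> \<epsilon>"
    proof -
      have "2 powr (- real n) \<le> exp (ln \<epsilon>)"
        unfolding powr_def using n1 by simp
      then show ?thesis using \<epsilon>(1) by simp
    qed
    moreover have "exp (D \<gamma>) \<le> \<epsilon> powr (- \<zeta>)"
    proof -
      have "D \<gamma> \<le> D h + b"
        unfolding \<gamma>_def using he(2) by (intro b) auto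
      also have "\<dots> \<le> \<zeta>' * (real n * ln 2) + b"
        using he(3) by (simp add: mult_ac)
      also have "\<dots> \<le> \<zeta>' * (- ln \<epsilon> + ln 2) + b"
        using n2 \<zeta>(1) by (intro add_right_mono mult_left_mono) auto
      also have "\<dots> \<le> - \<zeta> * ln \<epsilon>"
      proof -
        have "\<zeta>' * ln 2 + b < - ln \<epsilon> * (\<zeta> - \<zeta>')"
          using ln2 \<zeta>(2) by (simp add: pos_divide_less_eq)
        then show ?thesis by (simp add: algebra_simps)
      qed
      finally show ?thesis
        using \<epsilon>(1) by (simp add: powr_def)
    qed
    ultimately show ?thesis
      using he(5) by (intro bexI[of _ \<gamma>]) auto
  qed
  moreover have "exp (- L) > 0" by simp
  ultimately show ?thesis
    unfolding approx_exponent_def using \<zeta> 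
    by (intro Inf_lower) (auto intro!: exI[of _ "exp (- L)"])
qed

section \<open>Borel-Cantelli along dyadic radii\<close>

text \<open>At radius \<open>2 powr (- real n)\<close> the missed set has measure at most of the
  order of the radius to the power \<open>2 * s * a' * \<theta> - d\<close>, up to losses in
  \<open>\<eta>\<close>. The hypothesis on \<open>s\<close> makes this power positive, so the bounds
  decay geometrically.\<close>

lemma AE_eventually_hits:
  fixes s :: real
  assumes H: "subgroup H G" "closed H"
    and mG: "haar_measure G UNIV mG" and mH: "haar_measure G H mH"
    and mX: "quotient_measure G H mG mH mX"
    and \<Gamma>: "subgroup \<Gamma> G" and mY: "invariant_prob G \<Gamma> mY"
    and metric: "Metric_space (lcosets H) dst"
    and topology: "Metric_space.mtopology (lcosets H) dst = left_quotient G H"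
    and D: "proper_size D"
    and growth: "volume_growth G H mH D a' a"
    and dim: "local_dimension G H mX dst d' d"
    and rate: "mean_ergodic_rate G H mH D mY \<theta>"
    and s: "d / 2 < s * a' * \<theta>"
  shows "\<exists>K. compact K \<and> (AE y in mY. \<forall>\<^sub>F n in sequentially.
    \<exists>h\<in>H. \<exists>e\<in>K. D h \<le> s * real n * ln 2 \<and> y #> h = \<Gamma> #> e \<and> dst (e <# H) (g <# H) \<le> 2 powr (- real n))"
proof -
  interpret X: Metric_space "lcosets H" dst by (rule metric)
  interpret Y: prob_space mY by (rule prob_space_mY[OF \<Gamma> mY])
  let ?x = "g <# H" and ?p = "\<lambda>g. \<Gamma> #> g"
  let ?\<epsilon> = "\<lambda>n. 2 powr (- real n)" and ?t = "\<lambda>n. s * real n * ln 2"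
  have x: "?x \<in> lcosets H"
    by (auto simp: LCOSETS_def)
  have a': "0 < a'" and d: "0 < d" and \<theta>: "0 < \<theta>"
    using growth dim rate by (auto simp: volume_growth_def local_dimension_def mean_ergodic_rate_def)
  have "0 < s * a' * \<theta>"
    using s d by linarith
  then have s0: "0 < s"
    using a' \<theta> by (simp add: zero_less_mult_iff)
  \<comment> \<open>At \<open>\<eta> = 0\<close> the rate is
    \<open>2 * s * a' * \<theta> - d\<close>, which is positive; continuity preserves this for small
    \<open>\<eta>\<close>.\<close>
  have "((\<lambda>\<eta>. 2 * s * (a' - \<eta>) * (\<theta> - \<eta>) - (d + \<eta>)) \<longlongrightarrow> 2 * s * (a' - 0) * (\<theta> - 0) - (d + 0)) (at_right 0)"
    by (intro tendsto_intros)
  moreover have "0 < 2 * s * (a' - 0) * (\<theta> - 0) - (d + 0)"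
    using s by simp
  ultimately have "\<forall>\<^sub>F \<eta> in at_right 0. 0 < 2 * s * (a' - \<eta>) * (\<theta> - \<eta>) - (d + \<eta>)"
    by (rule order_tendstoD)
  moreover have "\<forall>\<^sub>F \<eta> in at_right 0. \<eta> \<in> {0<..<min a' \<theta>}"
    using a' \<theta> by (intro eventually_at_right_real) simp
  ultimately have "\<forall>\<^sub>F \<eta> in at_right 0. 0 < 2 * s * (a' - \<eta>) * (\<theta> - \<eta>) - (d + \<eta>) \<and> \<eta> \<in> {0<..<min a' \<theta>}"
    by (rule eventually_conj)
  then obtain \<eta> where \<eta>: "0 < 2 * s * (a' - \<eta>) * (\<theta> - \<eta>) - (d + \<eta>)" "0 < \<eta>" "\<eta> < a'" "\<eta> < \<theta>"
    using eventually_happens'[OF trivial_limit_at_right_real] by fastforce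

  obtain W K c1 where W: "open W" "g \<in> W" and K: "compact K" and c1: "c1 > 0"
    and lift: "\<And>B. openin (left_quotient G H) B \<Longrightarrow> B \<subseteq> (\<lambda>g. g <# H) ` W \<Longrightarrow>
      \<exists>E. open E \<and> E \<subseteq> K \<and> (\<forall>g\<in>E. g <# H \<in> B) \<and> ennreal c1 * emeasure mX B \<le> emeasure mG E"
    by (rule open_lift[OF H mG mH mX, of g]) blast
  obtain c2 where c2: "c2 > 0"
    and lower: "\<And>E. open E \<Longrightarrow> E \<subseteq> K \<Longrightarrow> ennreal c2 * emeasure mG E \<le> emeasure mY (?p ` E)"
    by (rule quotient_measure_lower_bound[OF \<Gamma> mY mG K]) blast
  have "openin X.mtopology ((\<lambda>g. g <# H) ` W)"
    unfolding topology by (rule openin_left_quotient_image[OF H(1) W(1)])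
  \<comment> \<open>Because the metric induces the quotient topology, balls of radius below
    \<open>\<epsilon>1\<close> lie over \<open>W\<close> and can be lifted.\<close>
  then obtain \<epsilon>1 where \<epsilon>1: "\<epsilon>1 > 0" "X.mball ?x \<epsilon>1 \<subseteq> (\<lambda>g. g <# H) ` W"
    unfolding X.openin_mtopology using W(2) by blast
  have "compactin (left_quotient G H) {?x}"
    using x by (simp add: topspace_left_quotient)
  then obtain C3 \<epsilon>0 where C3: "C3 \<ge> 1" "\<epsilon>0 > 0"
    and dim': "\<And>\<epsilon>. 0 < \<epsilon> \<Longrightarrow> \<epsilon> < \<epsilon>0 \<Longrightarrow> ennreal (inverse C3 * \<epsilon> powr (d + \<eta>)) \<le> emeasure mX (X.mball ?x \<epsilon>)"
    using dim \<eta>(2) unfolding local_dimension_def by (metis singletonI)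
  obtain C2 t2 where C2: "C2 \<ge> 1"
    and growth': "\<And>t. t \<ge> t2 \<Longrightarrow> inverse C2 * exp (t * (a' - \<eta>)) \<le> ball_volume G H mH D \<one> t"
    using growth \<eta>(2) compact_sing[of \<one>] unfolding volume_growth_def by (metis singletonI)
  obtain C4 t4 where
    rate': "\<And>t f. t \<ge> t4 \<Longrightarrow> f \<in> L2 mY \<Longrightarrow>
      L2_norm mY (\<lambda>y. ball_average G H mH D \<one> t f y - (\<integral>z. f z \<partial>mY))
        \<le> C4 * ball_volume G H mH D \<one> t powr (- \<theta> + \<eta>) * L2_norm mY f"
    using rate \<eta>(2) compact_sing[of \<one>] unfolding mean_ergodic_rate_def by (metis singletonI)

  \<comment> \<open>The product of the constants for \<open>mG\<close> against \<open>mY\<close>,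
    for the lift and for the local dimension: the projected lift of the \<open>n\<close>-th ball has
    \<open>mY\<close>-measure at least \<open>c * ?\<epsilon> n powr (d + \<eta>)\<close>.\<close>
  define c where "c = c2 * c1 * inverse C3"
  have c: "c > 0" using c1 c2 C3 by (simp add: c_def)
  \<comment> \<open>\<open>exp q\<close> is the factor by which the bound on the missed set shrinks
    from one \<open>n\<close> to the next.\<close>
  define q where "q = - (2 * s * (a' - \<eta>) * (\<theta> - \<eta>) - (d + \<eta>)) * ln 2"
  have q: "q < 0"
    unfolding q_def using \<eta>(1) by (intro mult_neg_pos) auto
  \<comment> \<open>\<open>C4\<close> enters through the squared mean ergodic estimate,
    \<open>C2\<close> through the lower bound on the ball volume, and \<open>c\<close> through
    division by the measure of the target.\<close>
  define M where "M = C4\<^sup>2 * inverse C2 powr (2 * (- \<theta> + \<eta>)) / c"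

  have "\<forall>\<^sub>F n in sequentially. ?\<epsilon> n < \<epsilon>1 \<and> ?\<epsilon> n < \<epsilon>0 \<and> t2 / (s * ln 2) \<le> real n \<and> t4 / (s * ln 2) \<le> real n"
    using \<epsilon>1(1) C3(2) order_tendstoD(2)[OF two_powr_minus_tendsto_0]
      filterlim_real_sequentially[unfolded filterlim_at_top]
    by (intro eventually_conj) auto
  then obtain n0 where n0: "\<And>n. n \<ge> n0 \<Longrightarrow>
      ?\<epsilon> n < \<epsilon>1 \<and> ?\<epsilon> n < \<epsilon>0 \<and> t2 / (s * ln 2) \<le> real n \<and> t4 / (s * ln 2) \<le> real n"
    by (auto simp: eventually_sequentially)

  have step: "\<exists>Z\<in>sets mY. measure mY Z \<le> M * exp q ^ n \<and> (\<forall>y\<in>space mY - Z.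
      \<exists>h\<in>H. \<exists>e\<in>K. D h \<le> ?t n \<and> y #> h = \<Gamma> #> e \<and> dst (e <# H) ?x \<le> ?\<epsilon> n)"
    if n: "n \<ge> n0" for n
  proof -
    have \<epsilon>: "?\<epsilon> n < \<epsilon>1" "?\<epsilon> n < \<epsilon>0" and t: "t2 \<le> ?t n" "t4 \<le> ?t n"
      using n0[OF n] s0 by (simp_all add: pos_divide_le_eq mult_ac)
    let ?B = "X.mball ?x (?\<epsilon> n)"
    have B: "openin (left_quotient G H) ?B"
      unfolding topology[symmetric] by (rule X.openin_mball)
    have "?B \<subseteq> (\<lambda>g. g <# H) ` W"
      using \<epsilon>1(2) X.mball_subset_concentric[of "?\<epsilon> n" \<epsilon>1 ?x] \<epsilon>(1) by (meson less_imp_le order_trans)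
    from lift[OF B this] obtain E where E: "open E" "E \<subseteq> K" "\<forall>g\<in>E. g <# H \<in> ?B"
        "ennreal c1 * emeasure mX ?B \<le> emeasure mG E"
      by blast
    define m where "m = measure mY (?p ` E)"
    have "ennreal (c * ?\<epsilon> n powr (d + \<eta>)) = ennreal c2 * (ennreal c1 * ennreal (inverse C3 * ?\<epsilon> n powr (d + \<eta>)))"
      using c1 c2 C3 by (simp add: c_def ennreal_mult mult.assoc)
    also have "\<dots> \<le> ennreal c2 * (ennreal c1 * emeasure mX ?B)"
      using \<epsilon>(2) by (intro mult_left_mono dim') auto
    also have "\<dots> \<le> ennreal c2 * emeasure mG E"
      by (intro mult_left_mono E) auto
    also have "\<dots> \<le> emeasure mY (?p ` E)"
      by (rule lower[OF E(1,2)])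
    finally have m: "c * ?\<epsilon> n powr (d + \<eta>) \<le> m"
      by (simp add: m_def Y.emeasure_eq_measure)
    then have m0: "m > 0"
      using c by (smt (verit) mult_pos_pos powr_gt_zero)
    define V where "V = ball_volume G H mH D \<one> (?t n)"
    have pE: "?p ` E \<in> sets mY"
      by (rule rcoset_image_in_sets[OF \<Gamma> mY E(1)])
    obtain Z where Z: "Z \<in> sets mY" "measure mY Z * m \<le> (C4 * V powr (- \<theta> + \<eta>))\<^sup>2"
      and hit: "\<And>y. y \<in> space mY - Z \<Longrightarrow> \<exists>h\<in>H. D h \<le> ?t n \<and> y #> h \<in> ?p ` E"
      using missing_set_bound[OF H(2) mH \<Gamma> mY D pE, of "?t n" "C4 * V powr (- \<theta> + \<eta>)"]
        m0 rate'[OF t(2)] by (auto simp: m_def V_def)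
    have V: "inverse C2 * exp (?t n * (a' - \<eta>)) \<le> V"
      unfolding V_def by (rule growth'[OF t(1)])
    have C2': "0 < inverse C2" using C2 by simp
    have "(C4 * V powr (- \<theta> + \<eta>))\<^sup>2 = C4\<^sup>2 * V powr (2 * (- \<theta> + \<eta>))"
      by (simp add: power_mult_distrib power2_eq_square powr_add[symmetric])
    \<comment> \<open>The exponent is negative because \<open>\<eta> < \<theta>\<close>, so a lower
      bound on the volume bounds its power from above.\<close>
    also have "\<dots> \<le> C4\<^sup>2 * (inverse C2 * exp (?t n * (a' - \<eta>))) powr (2 * (- \<theta> + \<eta>))"
      using V C2' \<eta>(4) by (intro mult_left_mono powr_mono2') auto
    also have "\<dots> = (M * c) * exp (?t n * (a' - \<eta>) * (2 * (- \<theta> + \<eta>)))"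
      using C2' c by (simp add: M_def powr_mult exp_powr_real)
    finally have "measure mY Z * m \<le> (M * c) * exp (?t n * (a' - \<eta>) * (2 * (- \<theta> + \<eta>)))"
      using Z(2) by linarith
    moreover have "measure mY Z * (c * ?\<epsilon> n powr (d + \<eta>)) \<le> measure mY Z * m"
      using m by (intro mult_left_mono) auto
    \<comment> \<open>Writing both sides as exponentials lets the division merge the two rates into
      \<open>real n * q\<close>.\<close>
    moreover have "?\<epsilon> n powr (d + \<eta>) = exp (- real n * ln 2 * (d + \<eta>))"
      by (simp add: powr_powr) (simp add: powr_def mult_ac)
    ultimately have "c * (measure mY Z * exp (- real n * ln 2 * (d + \<eta>)))
        \<le> c * (M * exp (?t n * (a' - \<eta>) * (2 * (- \<theta> + \<eta>))))"
      by (simp add: mult_ac)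
    then have "measure mY Z * exp (- real n * ln 2 * (d + \<eta>)) \<le> M * exp (?t n * (a' - \<eta>) * (2 * (- \<theta> + \<eta>)))"
      using c by simp
    then have "measure mY Z \<le> M * exp (?t n * (a' - \<eta>) * (2 * (- \<theta> + \<eta>))) / exp (- real n * ln 2 * (d + \<eta>))"
      by (simp add: pos_le_divide_eq)
    also have "\<dots> = M * exp (?t n * (a' - \<eta>) * (2 * (- \<theta> + \<eta>)) - (- real n * ln 2 * (d + \<eta>)))"
      by (simp only: exp_diff times_divide_eq_right)
    also have "?t n * (a' - \<eta>) * (2 * (- \<theta> + \<eta>)) - (- real n * ln 2 * (d + \<eta>)) = real n * q"
      by (simp add: q_def algebra_simps)
    finally have "measure mY Z \<le> M * exp q ^ n"
      by (simp add: exp_of_nat_mult)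
    moreover have "\<exists>h\<in>H. \<exists>e\<in>K. D h \<le> ?t n \<and> y #> h = \<Gamma> #> e \<and> dst (e <# H) ?x \<le> ?\<epsilon> n"
      if y: "y \<in> space mY - Z" for y
    proof -
      obtain h e where he: "h \<in> H" "D h \<le> ?t n" "e \<in> E" "y #> h = \<Gamma> #> e"
        using hit[OF y] by blast
      then have "dst (e <# H) ?x \<le> ?\<epsilon> n"
        using bspec[OF E(3) he(3)] X.commute[of ?x "e <# H"] by (simp add: X.in_mball)
      then show ?thesis
        using he E(2) by blast
    qed
    ultimately show ?thesis
      using Z(1) by blast
  qed

  \<comment> \<open>The estimates hold from \<open>n0\<close> on, so the sets are indexed by
    \<open>n = k + n0\<close>; the shift does not affect an eventual statement.\<close>
  have "\<forall>k. \<exists>Z. Z \<in> sets mY \<and> measure mY Z \<le> M * exp q ^ (k + n0) \<and> (\<forall>y\<in>space mY - Z.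
      \<exists>h\<in>H. \<exists>e\<in>K. D h \<le> ?t (k + n0) \<and> y #> h = \<Gamma> #> e \<and> dst (e <# H) ?x \<le> ?\<epsilon> (k + n0))"
    using step by (metis le_add2)
  then obtain Z where Z: "\<And>k. Z k \<in> sets mY" "\<And>k. measure mY (Z k) \<le> M * exp q ^ (k + n0)"
    "\<And>k y. y \<in> space mY - Z k \<Longrightarrow>
      \<exists>h\<in>H. \<exists>e\<in>K. D h \<le> ?t (k + n0) \<and> y #> h = \<Gamma> #> e \<and> dst (e <# H) ?x \<le> ?\<epsilon> (k + n0)"
    by metis
  have "summable (\<lambda>k. M * exp q ^ n0 * exp q ^ k)"
    using q by (intro summable_mult summable_geometric) simp
  then have "summable (\<lambda>k. measure mY (Z k))"
    by (rule summable_comparison_test'[where N = 0]) (use Z(2) in \<open>simp add: power_add mult_ac\<close>)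
  \<comment> \<open>Summability puts almost every \<open>y\<close> outside all but finitely many of
    the exceptional sets.\<close>
  then have "AE y in mY. \<forall>\<^sub>F k in sequentially. y \<in> space mY - Z k"
    using Z(1) by (intro borel_cantelli_AE1) (auto simp: Y.emeasure_finite less_top[symmetric])
  then have "AE y in mY. \<forall>\<^sub>F n in sequentially.
      \<exists>h\<in>H. \<exists>e\<in>K. D h \<le> ?t n \<and> y #> h = \<Gamma> #> e \<and> dst (e <# H) ?x \<le> ?\<epsilon> n"
  proof (rule AE_mp, intro AE_I2 impI)
    fix y
    assume "\<forall>\<^sub>F k in sequentially. y \<in> space mY - Z k"
    then have "\<forall>\<^sub>F k in sequentially.
        \<exists>h\<in>H. \<exists>e\<in>K. D h \<le> ?t (k + n0) \<and> y #> h = \<Gamma> #> e \<and> dst (e <# H) ?x \<le> ?\<epsilon> (k + n0)"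
      by (rule eventually_mono) (rule Z(3))
    then show "\<forall>\<^sub>F n in sequentially.
        \<exists>h\<in>H. \<exists>e\<in>K. D h \<le> ?t n \<and> y #> h = \<Gamma> #> e \<and> dst (e <# H) ?x \<le> ?\<epsilon> n"
      by (rule eventually_sequentially_seg[THEN iffD1])
  qed
  then show ?thesis
    using K by blast
qed

end

section \<open>Transfer to almost every coset and passage to the limiting exponent\<close>

theorem theorem3p2:
  fixes G :: "('g::{second_countable_topology, t2_space}, 'm) monoid_scheme" (structure)
    and H \<Gamma> :: "'g set"
    and mG mH :: "'g measure"
    and mX mY :: "'g set measure"
    and dst :: "'g set \<Rightarrow> 'g set \<Rightarrow> real"
    and D :: "'g \<Rightarrow> real"
    and a a' d d' \<theta> :: real
  assumes "lcsc_group G"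
    and "subgroup H G" and "closed H" and "unimodular G H"
    and "haar_measure G UNIV mG" and "haar_measure G H mH"
    and "quotient_measure G H mG mH mX"
    and "discrete_lattice G \<Gamma>" and "invariant_prob G \<Gamma> mY"
    and "ergodic_action G \<Gamma> mX"
    and "Metric_space (lcosets H) dst"
    and "Metric_space.mtopology (lcosets H) dst = left_quotient G H"
    and "proper_size D"
    and "lipschitz_action G H dst"
    and "coarsely_stable G D"
    and "volume_growth G H mH D a' a"
    and "local_dimension G H mX dst d' d"
    and "mean_ergodic_rate G H mH D mY \<theta>"
  shows "\<forall>x0 \<in> lcosets H. AE x in mX.
    approx_exponent G \<Gamma> dst D x x0 \<le> ereal ((d - d' / 2) / (a' * \<theta>))"
proof
  interpret lcsc_group G by fact
  fix x0 assume "x0 \<in> lcosets H"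
  then obtain g0 where g0: "x0 = g0 <# H"
    by (auto simp: LCOSETS_def)
  have \<Gamma>: "subgroup \<Gamma> G"
    using \<open>discrete_lattice G \<Gamma>\<close> by (simp add: discrete_lattice_def)
  let ?\<kappa> = "(d - d' / 2) / (a' * \<theta>)"
  have pos: "0 < a'" "0 < \<theta>" "0 < d'" "d' \<le> d"
    using assms by (auto simp: volume_growth_def local_dimension_def mean_ergodic_rate_def)
  then have \<kappa>: "0 \<le> ?\<kappa>"
    by simp
  \<comment> \<open>Exponents strictly above the claimed value come first: strictness leaves room
    for an intermediate rate \<open>s\<close>, whose distance to \<open>\<zeta>\<close> absorbs the
    additive constants.\<close>
  have "AE x in mX. approx_exponent G \<Gamma> dst D x x0 \<le> ereal \<zeta>" if \<zeta>: "?\<kappa> < \<zeta>" for \<zeta>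
  proof -
    obtain s where s: "?\<kappa> < s" "s < \<zeta>"
      using dense[OF \<zeta>] by blast
    \<comment> \<open>This is where \<open>d' \<le> d\<close> enters: the claimed exponent is at
      least the threshold \<open>d / (2 * a' * \<theta>)\<close> of the Borel-Cantelli
      argument.\<close>
    have "d / 2 \<le> d - d' / 2"
      using pos by simp
    also have "\<dots> < s * (a' * \<theta>)"
      using s(1) pos by (simp add: pos_divide_less_eq)
    finally have ds: "d / 2 < s * a' * \<theta>"
      by (simp add: mult.assoc)
    obtain K where K: "compact K" and AE: "AE y in mY. \<forall>\<^sub>F n in sequentially.
        \<exists>h\<in>H. \<exists>e\<in>K. D h \<le> s * real n * ln 2 \<and> y #> h = \<Gamma> #> e \<and> dst (e <# H) x0 \<le> 2 powr (- real n)"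
      using AE_eventually_hits[OF assms(2,3,5,6,7) \<Gamma> assms(9,11,12,13,16,17,18) ds, of g0]
      unfolding g0 by blast
    from AE obtain N where N: "N \<in> null_sets mY" "{y \<in> space mY. \<not> (\<forall>\<^sub>F n in sequentially.
        \<exists>h\<in>H. \<exists>e\<in>K. D h \<le> s * real n * ln 2 \<and> y #> h = \<Gamma> #> e \<and> dst (e <# H) x0 \<le> 2 powr (- real n))} \<subseteq> N"
      by (auto elim!: AE_E simp: null_sets_def)
    \<comment> \<open>The exceptional set \<open>N\<close> pulls back to a Haar null set, so almost
      every coset has a representative outside it, and any representative determines the same
      \<open>x\<close>.\<close>
    have "AE x in mX. \<exists>g\<in>x. g \<notin> {g. \<Gamma> #> g \<in> N}"
      by (rule AE_coset_avoids_null[OF assms(2,3,5,6,7) haar_null_if_quotient_null[OF \<Gamma> assms(9,5) N(1)]])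
    then show ?thesis
    proof (rule AE_mp, intro AE_I2 impI)
      fix x assume x: "x \<in> space mX" "\<exists>g\<in>x. g \<notin> {g. \<Gamma> #> g \<in> N}"
      then obtain g k where gk: "x = k <# H" "g \<in> x" "\<Gamma> #> g \<notin> N"
        by (auto simp: space_mX[OF assms(2,3,5,6,7)])
      then have "k <# H = g <# H"
        by (simp only: lcoset_eq_iff[OF assms(2)] mem_l_coset)
      then have g: "x = g <# H" using gk by simp
      have "\<forall>\<^sub>F n in sequentially. \<exists>h\<in>H. \<exists>e\<in>K. D h \<le> s * real n * ln 2 \<and>
          \<Gamma> #> g #> h = \<Gamma> #> e \<and> dst (e <# H) x0 \<le> 2 powr (- real n)"
        using N(2) gk(3) rcoset_in_mY[OF \<Gamma> assms(9), of g] by blast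
      then have "\<forall>\<^sub>F n in sequentially. \<exists>h\<in>H. \<exists>e\<in>K. D h \<le> s * real n * ln 2 \<and>
          \<Gamma> #> (g \<otimes> h) = \<Gamma> #> e \<and> dst (e <# H) x0 \<le> 2 powr (- real n)"
        by (simp add: coset_mult_assoc carrier_UNIV)
      then show "approx_exponent G \<Gamma> dst D x x0 \<le> ereal \<zeta>"
        unfolding g using \<kappa> s
        by (intro approx_exponent_le[OF assms(15,2) \<Gamma> K, of s]) auto
    qed
  qed
  \<comment> \<open>A sequence decreasing to \<open>?\<kappa>\<close> leaves countably many almost
    sure statements, which hold simultaneously almost surely.\<close>
  then have "AE x in mX. approx_exponent G \<Gamma> dst D x x0 \<le> ereal (?\<kappa> + inverse (real (Suc n)))" for n
    by (simp add: inverse_positive_iff_positive)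
  then have "AE x in mX. \<forall>n. approx_exponent G \<Gamma> dst D x x0 \<le> ereal (?\<kappa> + inverse (real (Suc n)))"
    by (simp add: AE_all_countable)
  then show "AE x in mX. approx_exponent G \<Gamma> dst D x x0 \<le> ereal ?\<kappa>"
  proof (rule AE_mp, intro AE_I2 impI)
    fix x assume le: "\<forall>n. approx_exponent G \<Gamma> dst D x x0 \<le> ereal (?\<kappa> + inverse (real (Suc n)))"
    have "(\<lambda>n. ?\<kappa> + inverse (real (Suc n))) \<longlonglongrightarrow> ?\<kappa> + 0"
      by (intro tendsto_intros LIMSEQ_inverse_real_of_nat)
    then have "(\<lambda>n. ereal (?\<kappa> + inverse (real (Suc n)))) \<longlonglongrightarrow> ereal ?\<kappa>"
      by simp
    then show "approx_exponent G \<Gamma> dst D x x0 \<le> ereal ?\<kappa>"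
      by (rule LIMSEQ_le_const) (use le in blast)
  qed
qed

end
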